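(* Consider on $\mathbb{R}^3$ the geometric gradient-flow equations for closed one-forms $\mathbf A\cdot d\mathbf x$ and closed two-forms $\mathbf B\cdot d\mathbf S$, $$\frac{\partial\mathbf A}{\partial t}=-\nabla(\mathbf v\cdot\mathbf A),\quad \mathbf v=-\Big(\boldsymbol\mu[\mathbf A]\,\operatorname{div}\frac{\delta E}{\delta\mathbf A}\Big)^{\sharp},\qquad\qquad \frac{\partial\mathbf B}{\partial t}=\operatorname{curl}(\mathbf v\times\mathbf B),\quad \mathbf v=\Big(\boldsymbol\mu[\mathbf B]\times\operatorname{curl}\frac{\delta E}{\delta\mathbf B}\Big)^{\sharp},$$ where $\operatorname{curl}\boldsymbol\mu[\mathbf A]=0$ and $\operatorname{div}\boldsymbol\mu[\mathbf B]=0$, and $\mathbf v$ is sufficiently smooth. These equations have singular solutions of the form $$\boldsymbol\kappa(\mathbf x,t)=\sum_{a=0}^N\int\mathbf p_a(s,t)\,\delta(\mathbf x-\mathbf q_a(s,t))\,ds\qquad(\boldsymbol\kappa=\mathbf A\text{ or }\boldsymbol\kappa=\mathbf B),$$ where, for closed one-forms $\mathbf A$, $$\dot{\mathbf q}_a=\mathbf v(\mathbf x)\big|_{\mathbf x=\mathbf q_a},\qquad \dot{\mathbf p}_a=\mathbf p_a\,(\nabla\cdot\mathbf v)(\mathbf x)\big|_{\mathbf x=\mathbf q_a}-\nabla\mathbf v(\mathbf x)\big|_{\mathbf x=\mathbf q_a}\cdot\mathbf p_a,$$ and, for closed two-forms $\mathbf B$, $$\dot{\mathbf q}_a=\mathbf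 v(\mathbf x)\big|_{\mathbf x=\mathbf q_a},\qquad \dot{\mathbf p}_a=\mathbf p_a^{T}\cdot\nabla\mathbf v(\mathbf x)\big|_{\mathbf x=\mathbf q_a}.$$
   Context: $E$ is an energy functional with variational derivatives $\delta E/\delta\mathbf A$, $\delta E/\delta\mathbf B$ taken with respect to the $L^2$ pairing, and $\boldsymbol\mu[\mathbf A]$ (resp. $\boldsymbol\mu[\mathbf B]$) is a mobility functional with values in one-forms (resp. two-forms), written as vector fields. The sharp $(\cdot)^\sharp$ raises the index with the Euclidean metric, so it is the identity on Cartesian components. The variable $s$ is a coordinate on a submanifold of $\mathbb{R}^3$ (curve or surface), $\mathbf q_a(s,t)\in\mathbb{R}^3$, $\mathbf p_a(s,t)\in\mathbb{R}^3$, and the dot denotes $\partial/\partial t$. Index conventions: $(\nabla\mathbf v\cdot\mathbf p)_i=\sum_j(\partial_iv^j)\,p_j$ and $(\mathbf p^T\cdot\nabla\mathbf v)^i=\sum_jp^j\,\partial_jv^i$. Closed means $\operatorname{curl}\mathbf A=0$, respectively $\operatorname{div}\mathbf B=0$, in the sense of distributions. Solutions are weak (tested against smooth compactly supported vector fields $\boldsymbol\phi(\mathbf x)$): the assertion is that if the singular expression is closed and $(\mathbf p_a,\mathbf q_a)$ satisfy the stated evolution equations, then it solves the corresponding equation in the sense of distributions. For closed forms the right-hand sides are $-\mathcal{L}_{\mathbf v}\mathbf A=-\big((\mathbf v\cdot\nabla)\mathbf A+A_j\nabla v^j\big)$ and $-\mathcal{L}_{\mathbf v}\mathbf B=\mathbf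 B^T\cdot\nabla\mathbf v-\mathbf v^T\cdot\nabla\mathbf B-(\nabla\cdot\mathbf v)\mathbf B$, with $\mathcal{L}$ the Lie derivative. *)

theory Defs
  imports "HOL-Analysis.Analysis"
begin

text \<open>
  Vector fields on Euclidean 3-space are given by their Cartesian components. One-forms
  \<open>A \<cdot> dx\<close> and two-forms \<open>B \<cdot> dS\<close> are identified with their coefficient vectors, and raising an
  index with the Euclidean metric is the identity on components.
\<close>

definition partial :: "3 \<Rightarrow> (real^3 \<Rightarrow> real) \<Rightarrow> real^3 \<Rightarrow> real" where
  "partial i f x = frechet_derivative f (at x) (axis i 1)"

definition grad :: "(real^3 \<Rightarrow> real) \<Rightarrow> real^3 \<Rightarrow> real^3" where
  "grad f x = (\<chi> i. partial i f x)"

definition divergence :: "(real^3 \<Rightarrow> real^3) \<Rightarrow> real^3 \<Rightarrow> real" where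
  "divergence w x = (\<Sum>i\<in>UNIV. partial i (\<lambda>y. w y $ i) x)"

definition curl :: "(real^3 \<Rightarrow> real^3) \<Rightarrow> real^3 \<Rightarrow> real^3" where
  "curl w x = vector
     [partial 2 (\<lambda>y. w y $ 3) x - partial 3 (\<lambda>y. w y $ 2) x,
      partial 3 (\<lambda>y. w y $ 1) x - partial 1 (\<lambda>y. w y $ 3) x,
      partial 1 (\<lambda>y. w y $ 2) x - partial 2 (\<lambda>y. w y $ 1) x]"

text \<open>The two contractions of \<open>\<nabla>w\<close> with \<open>p\<close>: \<open>(\<nabla>w \<cdot> p)\<^sub>i = \<Sum>\<^sub>j (\<partial>\<^sub>i w\<^sub>j) p\<^sub>j\<close> and
  \<open>(p\<^sup>T \<cdot> \<nabla>w)\<^sub>i = \<Sum>\<^sub>j p\<^sub>j \<partial>\<^sub>j w\<^sub>i\<close>.\<close>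

definition grad_dot :: "(real^3 \<Rightarrow> real^3) \<Rightarrow> real^3 \<Rightarrow> real^3 \<Rightarrow> real^3" where
  "grad_dot w x p = (\<chi> i. \<Sum>j\<in>UNIV. partial i (\<lambda>y. w y $ j) x * p $ j)"

definition dot_grad :: "real^3 \<Rightarrow> (real^3 \<Rightarrow> real^3) \<Rightarrow> real^3 \<Rightarrow> real^3" where
  "dot_grad p w x = (\<chi> i. \<Sum>j\<in>UNIV. p $ j * partial j (\<lambda>y. w y $ i) x)"

subsection \<open>Test functions and distributions\<close>

primrec Ck :: "nat \<Rightarrow> (real^3 \<Rightarrow> real) \<Rightarrow> bool" where
  "Ck 0 f \<longleftrightarrow> continuous_on UNIV f"
| "Ck (Suc k) f \<longleftrightarrow> (\<forall>x. f differentiable (at x)) \<and> (\<forall>i. Ck k (partial i f))"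

definition test_function :: "(real^3 \<Rightarrow> real) \<Rightarrow> bool" where
  "test_function f \<longleftrightarrow> (\<forall>k. Ck k f) \<and> compact (closure {x. f x \<noteq> 0})"

definition test_field :: "(real^3 \<Rightarrow> real^3) \<Rightarrow> bool" where
  "test_field \<phi> \<longleftrightarrow> (\<forall>i. test_function (\<lambda>x. \<phi> x $ i))"

text \<open>
  A distribution is represented by its pairing. The pairing is a total function because the flow
  equations pair a singular field with products \<open>f v\<close> and \<open>\<phi> \<times> v\<close>, in which \<open>f\<close> and \<open>\<phi>\<close> are
  smooth with compact support but \<open>v\<close> need not be infinitely differentiable. Such pairings are
  meaningful for distributions of order zero, in particular for the singular fields below.
\<close>

type_synonym scalar_dist = "(real^3 \<Rightarrow> real) \<Rightarrow> real"
type_synonym vector_dist = "(real^3 \<Rightarrow> real^3) \<Rightarrow> real"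

definition regular_dist :: "(real^3 \<Rightarrow> real^3) \<Rightarrow> vector_dist" where
  "regular_dist w = (\<lambda>\<phi>. LINT x|lborel. w x \<bullet> \<phi> x)"

definition dist_grad :: "scalar_dist \<Rightarrow> vector_dist" where
  "dist_grad u = (\<lambda>\<phi>. - u (divergence \<phi>))"

definition dist_div :: "vector_dist \<Rightarrow> scalar_dist" where
  "dist_div A = (\<lambda>f. - A (grad f))"

definition dist_curl :: "vector_dist \<Rightarrow> vector_dist" where
  "dist_curl A = (\<lambda>\<phi>. A (curl \<phi>))"

definition dist_inner :: "(real^3 \<Rightarrow> real^3) \<Rightarrow> vector_dist \<Rightarrow> scalar_dist" where
  "dist_inner w A = (\<lambda>f. A (\<lambda>x. f x *\<^sub>R w x))"

text \<open>The distribution \<open>w \<times> A\<close>; the formula is the identity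
  \<open>(w \<times> a) \<bullet> \<phi> = a \<bullet> (\<phi> \<times> w)\<close>.\<close>

definition dist_cross :: "(real^3 \<Rightarrow> real^3) \<Rightarrow> vector_dist \<Rightarrow> vector_dist" where
  "dist_cross w A = (\<lambda>\<phi>. A (\<lambda>x. cross3 (\<phi> x) (w x)))"

definition closed_one_form :: "vector_dist \<Rightarrow> bool" where
  "closed_one_form A \<longleftrightarrow> (\<forall>\<phi>. test_field \<phi> \<longrightarrow> dist_curl A \<phi> = 0)"

definition closed_two_form :: "vector_dist \<Rightarrow> bool" where
  "closed_two_form B \<longleftrightarrow> (\<forall>f. test_function f \<longrightarrow> dist_div B f = 0)"

definition locally_integrable :: "(real^3 \<Rightarrow> real^3) \<Rightarrow> bool" where
  "locally_integrable w \<longleftrightarrow> (\<forall>K. compact K \<longrightarrow> set_integrable lborel K w)"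

subsection \<open>The gradient-flow equations\<close>

definition has_variational_derivative ::
    "(vector_dist \<Rightarrow> real) \<Rightarrow> vector_dist \<Rightarrow> (real^3 \<Rightarrow> real^3) \<Rightarrow> bool" where
  "has_variational_derivative E A D \<longleftrightarrow>
     (\<forall>\<phi>. test_field \<phi> \<longrightarrow>
       ((\<lambda>\<epsilon>. E (\<lambda>\<psi>. A \<psi> + \<epsilon> * regular_dist \<phi> \<psi>))
          has_real_derivative (LINT x|lborel. D x \<bullet> \<phi> x)) (at 0))"

definition one_form_velocity ::
    "(vector_dist \<Rightarrow> real) \<Rightarrow> (vector_dist \<Rightarrow> real^3 \<Rightarrow> real^3) \<Rightarrow>
     vector_dist \<Rightarrow> (real^3 \<Rightarrow> real^3) \<Rightarrow> bool" where
  "one_form_velocity E \<mu> A v \<longleftrightarrow>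
     locally_integrable (\<mu> A) \<and> closed_one_form (regular_dist (\<mu> A)) \<and>
     (\<exists>D. has_variational_derivative E A D \<and> (\<forall>x. D differentiable (at x)) \<and>
          v = (\<lambda>x. - (divergence D x *\<^sub>R \<mu> A x)))"

definition two_form_velocity ::
    "(vector_dist \<Rightarrow> real) \<Rightarrow> (vector_dist \<Rightarrow> real^3 \<Rightarrow> real^3) \<Rightarrow>
     vector_dist \<Rightarrow> (real^3 \<Rightarrow> real^3) \<Rightarrow> bool" where
  "two_form_velocity E \<mu> B v \<longleftrightarrow>
     locally_integrable (\<mu> B) \<and> closed_two_form (regular_dist (\<mu> B)) \<and>
     (\<exists>D. has_variational_derivative E B D \<and> (\<forall>x. D differentiable (at x)) \<and>
          v = (\<lambda>x. cross3 (\<mu> B x) (curl D x)))"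

text \<open>Weak solutions on the time interval \<open>T\<close>: test fields depend on \<open>x\<close> only and the time
  derivative (one-sided at end points of \<open>T\<close>) is the derivative of the pairing.\<close>

definition one_form_flow_solution ::
    "(vector_dist \<Rightarrow> real) \<Rightarrow> (vector_dist \<Rightarrow> real^3 \<Rightarrow> real^3) \<Rightarrow> real set \<Rightarrow>
     (real \<Rightarrow> vector_dist) \<Rightarrow> (real \<Rightarrow> real^3 \<Rightarrow> real^3) \<Rightarrow> bool" where
  "one_form_flow_solution E \<mu> T A v \<longleftrightarrow>
     (\<forall>t\<in>T. closed_one_form (A t) \<and> one_form_velocity E \<mu> (A t) (v t) \<and>
       (\<forall>\<phi>. test_field \<phi> \<longrightarrow>
          ((\<lambda>\<tau>. A \<tau> \<phi>) has_real_derivative - dist_grad (dist_inner (v t) (A t)) \<phi>)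
            (at t within T)))"

definition two_form_flow_solution ::
    "(vector_dist \<Rightarrow> real) \<Rightarrow> (vector_dist \<Rightarrow> real^3 \<Rightarrow> real^3) \<Rightarrow> real set \<Rightarrow>
     (real \<Rightarrow> vector_dist) \<Rightarrow> (real \<Rightarrow> real^3 \<Rightarrow> real^3) \<Rightarrow> bool" where
  "two_form_flow_solution E \<mu> T B v \<longleftrightarrow>
     (\<forall>t\<in>T. closed_two_form (B t) \<and> two_form_velocity E \<mu> (B t) (v t) \<and>
       (\<forall>\<phi>. test_field \<phi> \<longrightarrow>
          ((\<lambda>\<tau>. B \<tau> \<phi>) has_real_derivative dist_curl (dist_cross (v t) (B t)) \<phi>)
            (at t within T)))"

text \<open>The regularity of \<open>v\<close>: continuously differentiable in \<open>x\<close>, with \<open>v\<close> and its spatial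
  derivatives continuous in \<open>(t, x)\<close>.\<close>

definition C1_velocity :: "real set \<Rightarrow> (real \<Rightarrow> real^3 \<Rightarrow> real^3) \<Rightarrow> bool" where
  "C1_velocity T v \<longleftrightarrow>
     (\<forall>t\<in>T. \<forall>x. v t differentiable (at x)) \<and>
     continuous_on (T \<times> UNIV) (\<lambda>(t, x). v t x) \<and>
     (\<forall>i j. continuous_on (T \<times> UNIV) (\<lambda>(t, x). partial i (\<lambda>y. v t y $ j) x))"

subsection \<open>The singular fields\<close>

text \<open>The pairing of \<open>\<Sum>\<^sub>a \<integral> p\<^sub>a(s,t) \<delta>(x - q\<^sub>a(s,t)) ds\<close> with \<open>\<phi>\<close>, where the coordinate \<open>s\<close> of the
  \<open>a\<close>-th curve or surface ranges over \<open>S a\<close>.\<close>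

definition singular_field ::
    "nat \<Rightarrow> (nat \<Rightarrow> 's::euclidean_space set) \<Rightarrow> (nat \<Rightarrow> 's \<Rightarrow> real \<Rightarrow> real^3) \<Rightarrow>
     (nat \<Rightarrow> 's \<Rightarrow> real \<Rightarrow> real^3) \<Rightarrow> real \<Rightarrow> vector_dist" where
  "singular_field N S p q t =
     (\<lambda>\<phi>. \<Sum>a=0..N. LINT s|lebesgue_on (S a). p a s t \<bullet> \<phi> (q a s t))"

text \<open>Local finiteness: at each time the singular expression is a vector measure that is finite on
  compact sets, so that its pairing with a test field is an absolutely convergent integral.\<close>

definition locally_finite_singular ::
    "nat \<Rightarrow> (nat \<Rightarrow> 's::euclidean_space set) \<Rightarrow> (nat \<Rightarrow> 's \<Rightarrow> real \<Rightarrow> real^3) \<Rightarrow>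
     (nat \<Rightarrow> 's \<Rightarrow> real \<Rightarrow> real^3) \<Rightarrow> real set \<Rightarrow> bool" where
  "locally_finite_singular N S p q T \<longleftrightarrow>
     (\<forall>a\<in>{0..N}. \<forall>t\<in>T.
        (\<lambda>s. p a s t) \<in> borel_measurable (lebesgue_on (S a)) \<and>
        (\<lambda>s. q a s t) \<in> borel_measurable (lebesgue_on (S a)) \<and>
        (\<forall>K. compact K \<longrightarrow>
           integrable (lebesgue_on (S a)) (\<lambda>s. indicat_real K (q a s t) *\<^sub>R p a s t)))"

definition one_form_evolution ::
    "nat \<Rightarrow> (nat \<Rightarrow> 's set) \<Rightarrow> (nat \<Rightarrow> 's \<Rightarrow> real \<Rightarrow> real^3) \<Rightarrow>
     (nat \<Rightarrow> 's \<Rightarrow> real \<Rightarrow> real^3) \<Rightarrow> real set \<Rightarrow> (real \<Rightarrow> real^3 \<Rightarrow> real^3) \<Rightarrow> bool" where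
  "one_form_evolution N S p q T v \<longleftrightarrow>
     (\<forall>a\<in>{0..N}. \<forall>s\<in>S a. \<forall>t\<in>T.
        (q a s has_vector_derivative v t (q a s t)) (at t within T) \<and>
        (p a s has_vector_derivative
           divergence (v t) (q a s t) *\<^sub>R p a s t - grad_dot (v t) (q a s t) (p a s t))
          (at t within T))"

definition two_form_evolution ::
    "nat \<Rightarrow> (nat \<Rightarrow> 's set) \<Rightarrow> (nat \<Rightarrow> 's \<Rightarrow> real \<Rightarrow> real^3) \<Rightarrow>
     (nat \<Rightarrow> 's \<Rightarrow> real \<Rightarrow> real^3) \<Rightarrow> real set \<Rightarrow> (real \<Rightarrow> real^3 \<Rightarrow> real^3) \<Rightarrow> bool" where
  "two_form_evolution N S p q T v \<longleftrightarrow>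
     (\<forall>a\<in>{0..N}. \<forall>s\<in>S a. \<forall>t\<in>T.
        (q a s has_vector_derivative v t (q a s t)) (at t within T) \<and>
        (p a s has_vector_derivative dot_grad (p a s t) (v t) (q a s t)) (at t within T))"

end

theory Submission
  imports Defs
begin

text \<open>
  Differentiating \<open>p(s,t) \<bullet> \<phi>(q(s,t))\<close> along the evolution equations gives \<open>p \<bullet> \<Psi>(q)\<close>, where
  \<open>\<Psi> = (div \<phi>) v + curl (\<phi> \<times> v)\<close> for one-forms and \<open>\<Psi> = curl \<phi> \<times> v + grad (\<phi> \<bullet> v)\<close> for
  two-forms. The first summand is the weak form of the right-hand side; the second one pairs to zero
  because the field is closed. As \<open>\<phi> \<times> v\<close> and \<open>\<phi> \<bullet> v\<close> are only C1 with compact support, closedness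
  is extended to such arguments by mollification. The derivative passes under the integral over \<open>s\<close>
  by dominated convergence: for short times no trajectory travels further than distance 1 through a
  compact set, and \<open>p\<close> grows at most exponentially (Gronwall), so the difference quotients are
  dominated by \<open>|p(s,t)|\<close> restricted to those \<open>s\<close> with \<open>q(s,t)\<close> in a fixed ball.
\<close>

subsection \<open>Calculus of partial derivatives\<close>

text \<open>Both formulas for \<open>\<Psi>\<close> are Cartan's formula in weak form. The evolution
  of \<open>p\<close> and \<open>q\<close> transports the field by minus the Lie derivative, which
  splits into d of the contraction with \<open>v\<close> and the contraction of \<open>v\<close>
  with d. The latter is the distributional curl or divergence of the field, tested against
  \<open>\<phi> \<times> v\<close> or \<open>\<phi> \<bullet> v\<close>. The obstacle is domination
  over \<open>s\<close>: \<open>S a\<close> may have infinite measure, and local finiteness is given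
  at each time separately, without uniformity in time. A dominating function may therefore use
  \<open>p\<close> and \<open>q\<close> at the one time \<open>t\<close> only. Hence confinement and
  growth are needed in both time directions: a trajectory that meets the support of
  \<open>\<phi>\<close> at any moment of the window must be controlled by its data at
  \<open>t\<close>. The speed bound holds only inside a compact set, so the length of the window is
  chosen after that bound. A general \<open>vector_dist\<close> carries no continuity, so closedness
  is extended through the concrete integral: it suffices that the mollified derivatives converge
  pointwise, with a common bound and a common support.\<close>

lemma has_derivative_partial:
  assumes "(f has_derivative D) (at x)"
  shows "partial i f x = D (axis i 1)"
  using frechet_derivative_at[OF assms] by (simp add: partial_def)

lemma differentiable_has_derivative_partials:
  fixes f :: "real^3 \<Rightarrow> real"
  assumes "f differentiable (at x)"
  shows "(f has_derivative (\<lambda>h. \<Sum>i\<in>UNIV. h $ i * partial i f x)) (at x)"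
proof -
  obtain D where D: "(f has_derivative D) (at x)" using assms by (auto simp: differentiable_def)
  then have lin: "linear D" by (rule has_derivative_linear)
  have "D h = (\<Sum>i\<in>UNIV. h $ i * partial i f x)" for h
  proof -
    have "D h = D (\<Sum>i\<in>UNIV. h $ i *s axis i 1)" by (simp add: basis_expansion)
    also have "\<dots> = (\<Sum>i\<in>UNIV. h $ i * D (axis i 1))"
      by (simp add: linear_sum[OF lin] linear_cmul[OF lin] scalar_mult_eq_scaleR)
    finally show ?thesis by (simp add: has_derivative_partial[OF D])
  qed
  then have "D = (\<lambda>h. \<Sum>i\<in>UNIV. h $ i * partial i f x)" by auto
  with D show ?thesis by simp
qed

lemma partial_add:
  assumes "f differentiable (at x)" "g differentiable (at x)"
  shows "partial i (\<lambda>y. f y + g y) x = partial i f x + partial i g x"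
proof -
  obtain F G where F: "(f has_derivative F) (at x)" and G: "(g has_derivative G) (at x)"
    using assms by (auto simp: differentiable_def)
  show ?thesis
    using has_derivative_partial[OF has_derivative_add[OF F G]]
    by (simp add: has_derivative_partial[OF F] has_derivative_partial[OF G])
qed

lemma partial_diff:
  assumes "f differentiable (at x)" "g differentiable (at x)"
  shows "partial i (\<lambda>y. f y - g y) x = partial i f x - partial i g x"
proof -
  obtain F G where F: "(f has_derivative F) (at x)" and G: "(g has_derivative G) (at x)"
    using assms by (auto simp: differentiable_def)
  show ?thesis
    using has_derivative_partial[OF has_derivative_diff[OF F G]]
    by (simp add: has_derivative_partial[OF F] has_derivative_partial[OF G])
qed

lemma partial_mult:
  assumes "f differentiable (at x)" "g differentiable (at x)"
  shows "partial i (\<lambda>y. f y * g y) x = f x * partial i g x + partial i f x * g x"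
proof -
  obtain F G where F: "(f has_derivative F) (at x)" and G: "(g has_derivative G) (at x)"
    using assms by (auto simp: differentiable_def)
  show ?thesis
    using has_derivative_partial[OF has_derivative_mult[OF F G]]
    by (simp add: has_derivative_partial[OF F] has_derivative_partial[OF G])
qed

lemma partial_const: "partial i (\<lambda>y. c) = (\<lambda>x. 0)"
  by (rule ext, rule has_derivative_partial[OF has_derivative_const])

section \<open>Closure properties of the classes \<open>Ck\<close>\<close>

lemma Ck_differentiable: "Ck (Suc k) f \<Longrightarrow> f differentiable (at x)"
  by simp

lemma Ck_partial: "Ck (Suc k) f \<Longrightarrow> Ck k (partial i f)"
  by simp

lemma Ck_SucD: "Ck (Suc k) f \<Longrightarrow> Ck k f"
proof (induction k arbitrary: f)
  case 0
  then show ?case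
    by (auto intro!: continuous_at_imp_continuous_on differentiable_imp_continuous_within)
next
  case (Suc k)
  show ?case
    unfolding Ck.simps(2)[of k]
  proof (intro conjI allI)
    show "f differentiable (at x)" for x using Suc.prems by (rule Ck_differentiable)
    show "Ck k (partial i f)" for i using Suc.IH[OF Ck_partial[OF Suc.prems]] .
  qed
qed

lemma Ck_mono: "Ck n f \<Longrightarrow> m \<le> n \<Longrightarrow> Ck m f"
  by (induction n arbitrary: m) (auto simp: le_Suc_eq simp del: Ck.simps(2) dest: Ck_SucD)

lemma Ck_continuous_on: "Ck k f \<Longrightarrow> continuous_on A f"
  using Ck_mono[of k f 0] by (auto intro: continuous_on_subset)

lemma Ck_const: "Ck k (\<lambda>x. c)"
  by (induction k arbitrary: c) (auto simp: partial_const)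

lemma Ck_add: "Ck k f \<Longrightarrow> Ck k g \<Longrightarrow> Ck k (\<lambda>x. f x + g x)"
proof (induction k arbitrary: f g)
  case (Suc k)
  then have "partial i (\<lambda>x. f x + g x) = (\<lambda>x. partial i f x + partial i g x)" for i
    by (intro ext partial_add) auto
  with Suc show ?case by auto
qed (auto intro: continuous_intros)

lemma Ck_mult: "Ck k f \<Longrightarrow> Ck k g \<Longrightarrow> Ck k (\<lambda>x. f x * g x)"
proof (induction k arbitrary: f g)
  case (Suc k)
  then have eq: "partial i (\<lambda>x. f x * g x) = (\<lambda>x. f x * partial i g x + partial i f x * g x)" for i
    by (intro ext partial_mult) auto
  have "Ck k f" "Ck k g" using Suc.prems by (auto dest: Ck_SucD simp del: Ck.simps(2))
  with Suc show ?case by (auto simp: eq intro!: Ck_add)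
qed (auto intro: continuous_intros)

lemma Ck_diff: "Ck k f \<Longrightarrow> Ck k g \<Longrightarrow> Ck k (\<lambda>x. f x - g x)"
  using Ck_add[of k f "\<lambda>x. (-1) * g x"] Ck_mult[OF Ck_const[of k "-1"], of g] by simp

lemma Ck_sum: "(\<And>i. i \<in> I \<Longrightarrow> Ck k (f i)) \<Longrightarrow> Ck k (\<lambda>x. \<Sum>i\<in>I. f i x)"
  by (induction I rule: infinite_finite_induct) (auto intro: Ck_const Ck_add)

lemma partial_nth: "partial i (\<lambda>x. x $ j) = (\<lambda>x. if i = j then 1 else 0)"
proof
  fix x :: "real^3"
  have "((\<lambda>x. x $ j) has_derivative (\<lambda>x. x $ j)) (at x)"
    by (intro bounded_linear_imp_has_derivative bounded_linear_vec_nth)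
  from has_derivative_partial[OF this]
  show "partial i (\<lambda>x. x $ j) x = (if i = j then 1 else 0)" by (simp add: axis_def)
qed

lemma Ck_nth: "Ck k (\<lambda>x. x $ j)"
proof (cases k)
  case (Suc n)
  have "(\<lambda>x. x $ j) differentiable (at x)" for x :: "real^3"
    unfolding differentiable_def using bounded_linear_imp_has_derivative[OF bounded_linear_vec_nth]
    by blast
  then show ?thesis using Suc by (auto simp: partial_nth Ck_const)
qed (auto intro: continuous_intros)

subsection \<open>A smooth bump function\<close>

text \<open>The family is closed under differentiation, which makes smoothness of \<open>flat 0\<close> an induction.\<close>

definition flat :: "nat \<Rightarrow> real \<Rightarrow> real" where
  "flat m s = (if s > 0 then exp (- inverse s) * inverse s ^ m else 0)"

text \<open>From the right, put \<open>u = inverse s\<close>: the claim becomes that the exponential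
  beats every power of \<open>u\<close> at infinity. From the left the function is identically
  0.\<close>

lemma tendsto_flat_0: "(flat m \<longlongrightarrow> 0) (at 0)"
proof -
  have "((\<lambda>s. inverse s ^ m / exp (inverse s)) \<longlongrightarrow> (0::real)) (at_right 0)"
    by (rule filterlim_compose[OF tendsto_power_div_exp_0 filterlim_inverse_at_top_right])
  then have "(flat m \<longlongrightarrow> 0) (at_right 0)"
    by (rule Lim_transform_eventually)
       (auto simp: eventually_at_filter flat_def exp_minus field_simps)
  moreover have "(flat m \<longlongrightarrow> 0) (at_left 0)"
    by (rule Lim_transform_eventually[OF tendsto_const]) (auto simp: eventually_at_filter flat_def)
  ultimately show ?thesis by (simp add: filterlim_split_at)
qed

lemma flat_has_derivative:
  "(flat m has_real_derivative flat (m + 2) s - real m * flat (m + 1) s) (at s)"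
proof -
  consider "s > 0" | "s < 0" | "s = 0" by linarith
  then show ?thesis
  proof cases
    case 1
    have "((\<lambda>s. exp (- inverse s) * inverse s ^ m) has_real_derivative
        flat (m + 2) s - real m * flat (m + 1) s) (at s)"
    proof -
      have "((\<lambda>s. exp (- inverse s) * inverse s ^ m) has_real_derivative
          exp (- inverse s) * (inverse s * inverse s) * inverse s ^ m +
          exp (- inverse s) * (real m * inverse s ^ (m - 1) * - (inverse s * inverse s))) (at s)"
        using 1 by (auto intro!: derivative_eq_intros simp: power2_eq_square)
      moreover have "exp (- inverse s) * (inverse s * inverse s) * inverse s ^ m +
          exp (- inverse s) * (real m * inverse s ^ (m - 1) * - (inverse s * inverse s)) =
          flat (m + 2) s - real m * flat (m + 1) s"
        \<comment> \<open>The case split is due to truncated subtraction in \<open>m - 1\<close>;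
          for \<open>m = 0\<close> the factor \<open>real m\<close> removes that term.\<close>
        using 1 by (cases m) (simp_all add: flat_def algebra_simps)
      ultimately show ?thesis by simp
    qed
    then show ?thesis
    proof (rule has_field_derivative_transform_within_open[of _ _ _ "{0<..}"])
    qed (use 1 in \<open>auto simp: flat_def\<close>)
  next
    case 2
    have "((\<lambda>s. 0) has_real_derivative flat (m + 2) s - real m * flat (m + 1) s) (at s)"
      using 2 by (auto simp: flat_def)
    then show ?thesis
    proof (rule has_field_derivative_transform_within_open[of _ _ _ "{..<0}"])
    qed (use 2 in \<open>auto simp: flat_def\<close>)
  next
    case 3
    \<comment> \<open>The difference quotient at 0 is again a member of the family, so its limit is
      known. The equation holds at \<open>y = 0\<close> too, where division by zero gives 0.\<close>
    have "(\<lambda>y. (flat m y - flat m 0) / (y - 0)) = flat (m + 1)"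
      by (auto simp: flat_def fun_eq_iff field_simps)
    then show ?thesis using 3 tendsto_flat_0[of "m + 1"]
      by (simp add: has_field_derivative_iff flat_def)
  qed
qed

lemma Ck_flat_compose:
  assumes r: "\<And>n. Ck n r"
  shows "Ck k (\<lambda>x. flat m (r x))"
\<comment> \<open>Each differentiation raises the index of \<open>flat\<close>, so the induction
  hypothesis must cover all \<open>m\<close>.\<close>
proof (induction k arbitrary: m)
  case 0
  have "continuous_on UNIV (flat m)"
    by (intro continuous_at_imp_continuous_on ballI DERIV_isCont[OF flat_has_derivative])
  then show ?case using continuous_on_compose2[OF _ Ck_continuous_on[OF r[of 0]]] by auto
next
  case (Suc k)
  have d: "((\<lambda>x. flat m (r x)) has_derivative (\<lambda>h. (\<Sum>i\<in>UNIV. h $ i * partial i r x) *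
      (flat (m + 2) (r x) - real m * flat (m + 1) (r x)))) (at x)" for x
  proof -
    have "r differentiable (at x)" using r[of "Suc 0"] by simp
    from differentiable_has_derivative_partials[OF this]
    have "(flat m \<circ> r has_derivative (\<lambda>h. h * (flat (m + 2) (r x) - real m * flat (m + 1) (r x))) \<circ>
        (\<lambda>h. \<Sum>i\<in>UNIV. h $ i * partial i r x)) (at x)"
      using flat_has_derivative[of m "r x"]
      by (intro diff_chain_at)
        (auto simp: has_field_derivative_def mult_commute_abs)
    then show ?thesis by (simp add: o_def)
  qed
  have "partial i (\<lambda>x. flat m (r x)) = (\<lambda>x. partial i r x *
      (flat (m + 2) (r x) - real m * flat (m + 1) (r x)))" for i
  proof
    fix x
    have "(\<Sum>j\<in>UNIV. axis i 1 $ j * partial j r x) = partial i r x"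
      by (simp add: axis_def if_distrib if_distribR cong: if_cong)
    then show "partial i (\<lambda>x. flat m (r x)) x = partial i r x *
      (flat (m + 2) (r x) - real m * flat (m + 1) (r x))"
      using has_derivative_partial[OF d] by simp
  qed
  moreover have "Ck k (partial i r)" for i using r[of "Suc k"] by simp
  moreover have "(\<lambda>x. flat m (r x)) differentiable (at x)" for x
    using d[of x] unfolding differentiable_def by blast
  ultimately show ?case using Suc
    by (auto intro!: Ck_mult Ck_diff Ck_const)
qed

text \<open>The classical bump \<open>exp (- 1 / (r^2 - |x|^2))\<close>, divided by its integral.
  The integral is taken over the cube around the ball of radius \<open>r\<close>, because
  differentiation under the integral is later used over boxes.\<close>

lemma exists_smooth_kernel:
  fixes r :: real
  assumes "r > 0"
  obtains g where "\<And>k. Ck k g" "\<And>x. g x \<ge> 0" "\<And>x. norm x \<ge> r \<Longrightarrow> g x = 0"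
    "(g has_integral 1) (cbox (- vec r) (vec r))"
proof -
  \<comment> \<open>A sum of squares of coordinates instead of the norm makes the argument of
    \<open>flat 0\<close> a polynomial, to which the \<open>Ck\<close> closure rules apply.\<close>
  define h :: "real^3 \<Rightarrow> real" where "h x = flat 0 (r\<^sup>2 - (\<Sum>i\<in>UNIV. x $ i * x $ i))" for x
  let ?Q = "cbox (- vec r) (vec r) :: (real^3) set"
  have sq: "(\<Sum>i\<in>UNIV. x $ i * x $ i) = (norm x)\<^sup>2" for x :: "real^3"
    by (simp add: power2_norm_eq_inner inner_vec_def)
  have Ckh: "Ck k h" for k
    unfolding h_def by (intro Ck_flat_compose Ck_diff Ck_const Ck_sum Ck_mult Ck_nth)
  have nonneg: "h x \<ge> 0" for x by (simp add: h_def flat_def)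
  have supp: "h x = 0" if "norm x \<ge> r" for x
    using that assms by (simp add: h_def sq flat_def power_mono not_less)
  have h0: "h 0 > 0" using assms by (simp add: h_def sq flat_def)
  have cont: "continuous_on ?Q h" by (rule Ck_continuous_on[OF Ckh[of 0]])
  have Q0: "0 \<in> ?Q" using assms by (simp add: mem_box_cart)
  have int: "(h has_integral integral ?Q h) ?Q"
    using integrable_continuous[OF cont] by (rule integrable_integral)
  have "integral ?Q h \<ge> 0" using nonneg by (intro integral_nonneg integrable_continuous cont) auto
  moreover have "integral ?Q h \<noteq> 0"
  \<comment> \<open>A continuous nonnegative function with integral 0 over a nondegenerate box
    vanishes on it, contrary to \<open>h 0 > 0\<close>.\<close>
  proof
    assume "integral ?Q h = 0"
    then have "(h has_integral 0) ?Q" using int by simp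
    moreover have "box (- vec r) (vec r) \<noteq> ({} :: (real^3) set)"
      using assms by (auto simp: box_ne_empty(2) inner_axis Basis_vec_def)
    ultimately have "h 0 = 0"
      using has_integral_0_cbox_imp_0[OF cont _ _ _ Q0] nonneg by blast
    with h0 show False by simp
  qed
  ultimately have pos: "integral ?Q h > 0" by simp
  show thesis
  proof (rule that[of "\<lambda>x. inverse (integral ?Q h) * h x"])
    show "((\<lambda>x. inverse (integral ?Q h) * h x) has_integral 1) ?Q"
      using has_integral_mult_right[OF int, of "inverse (integral ?Q h)"] pos by simp
  qed (use pos nonneg supp in \<open>auto intro!: Ck_mult Ck_const Ckh simp del: Ck.simps\<close>)
qed

subsection \<open>Mollification\<close>

text \<open>Leibniz rule with the derivative falling on \<open>h\<close>, so \<open>w\<close>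
  contributes only its continuity. It is used with either factor of a mollification in the role of
  \<open>h\<close>.\<close>

lemma convolution_has_partials:
  fixes w h :: "real^3 \<Rightarrow> real" and a b :: "real^3"
  assumes w: "continuous_on UNIV w" and h: "Ck (Suc 0) h"
  defines "c \<equiv> \<lambda>x. integral (cbox a b) (\<lambda>y. w y * h (x - y))"
  shows "c differentiable (at x)"
    and "partial i c x = integral (cbox a b) (\<lambda>y. w y * partial i h (x - y))"
proof -
  \<comment> \<open>The Leibniz rule wants the derivative as a bounded linear function;
    \<open>blinfun_inner_left (axis i 1)\<close> is the \<open>i\<close>-th coordinate
    functional.\<close>
  define D where "D x y = (\<Sum>i\<in>UNIV. (w y * partial i h (x - y)) *\<^sub>R
      blinfun_inner_left (axis i 1 :: real^3))" for x y
  have cw: "continuous_on A (\<lambda>z. w (k z))" if "continuous_on A k" for A and k :: "'z::topological_space \<Rightarrow> real^3"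
    using continuous_on_compose2[OF w that] by auto
  have cp: "continuous_on A (\<lambda>z. partial j h (k z))" if "continuous_on A k"
    for A and k :: "'z::topological_space \<Rightarrow> real^3" and j
    using continuous_on_compose2[of UNIV "partial j h", OF _ that] h by auto
  have ch: "continuous_on A (\<lambda>z. h (k z))" if "continuous_on A k"
    for A and k :: "'z::topological_space \<Rightarrow> real^3"
    using continuous_on_compose2[OF Ck_continuous_on[OF h] that] by auto
  have cD: "continuous_on (UNIV \<times> cbox a b) (\<lambda>(x, y). D x y)"
    unfolding D_def case_prod_beta by (intro continuous_intros cw cp)
  have cDx: "continuous_on (cbox a b) (D x)"
    unfolding D_def by (intro continuous_intros cw cp)
  have "((\<lambda>x. w y * h (x - y)) has_derivative blinfun_apply (D x y)) (at x)" for x y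
  proof -
    have "h differentiable (at (x - y))" using h by simp
    from differentiable_has_derivative_partials[OF this]
    have "(h \<circ> (\<lambda>x. x - y) has_derivative
        (\<lambda>d. \<Sum>i\<in>UNIV. d $ i * partial i h (x - y)) \<circ> (\<lambda>d. d)) (at x)"
      by (intro diff_chain_at) (auto intro!: derivative_eq_intros)
    then have "((\<lambda>x. w y * h (x - y)) has_derivative
        (\<lambda>d. w y * (\<Sum>i\<in>UNIV. d $ i * partial i h (x - y)))) (at x)"
      by (intro has_derivative_mult_right) (simp add: o_def)
    also have "(\<lambda>d. w y * (\<Sum>i\<in>UNIV. d $ i * partial i h (x - y))) = blinfun_apply (D x y)"
      by (auto simp: D_def blinfun.sum_left blinfun.scaleR_left inner_axis sum_distrib_left
          intro!: ext sum.cong)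
    finally show ?thesis .
  qed
  then have "(c has_derivative blinfun_apply (integral (cbox a b) (D x))) (at x)"
    unfolding c_def by (intro leibniz_rule[of UNIV, simplified] cD integrable_continuous
        continuous_intros cw ch) auto
  then show "c differentiable (at x)"
    and "partial i c x = integral (cbox a b) (\<lambda>y. w y * partial i h (x - y))"
  proof -
    assume d: "(c has_derivative blinfun_apply (integral (cbox a b) (D x))) (at x)"
    show "c differentiable (at x)" using d by (auto simp: differentiable_def)
    have "partial i c x = blinfun_apply (integral (cbox a b) (D x)) (axis i 1)"
      by (rule has_derivative_partial[OF d])
    also have "\<dots> = integral (cbox a b) (\<lambda>y. blinfun_apply (D x y) (axis i 1))"
      by (rule blinfun_apply_integral[OF integrable_continuous[OF cDx]])
    also have "(\<lambda>y. blinfun_apply (D x y) (axis i 1)) = (\<lambda>y. w y * partial i h (x - y))"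
      by (auto simp: D_def blinfun.sum_left blinfun.scaleR_left inner_axis_axis
          if_distrib if_distribR cong: if_cong)
    finally show "partial i c x = integral (cbox a b) (\<lambda>y. w y * partial i h (x - y))" .
  qed
qed

lemma Ck_convolution:
  assumes w: "continuous_on UNIV w" and h: "\<And>n. Ck n h"
  shows "Ck k (\<lambda>x. integral (cbox a b) (\<lambda>y. w y * h (x - y)))"
  using h
proof (induction k arbitrary: h)
  case 0
  have cw: "continuous_on A (\<lambda>z. w (k z))" if "continuous_on A k"
    for A and k :: "(real^3) \<times> (real^3) \<Rightarrow> real^3"
    using continuous_on_compose2[OF w that] by auto
  have ch: "continuous_on A (\<lambda>z. h (k z))" if "continuous_on A k"
    for A and k :: "(real^3) \<times> (real^3) \<Rightarrow> real^3"
    using continuous_on_compose2[OF Ck_continuous_on[OF 0[of 0]] that] by auto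
  show ?case unfolding Ck.simps
    by (intro integral_continuous_on_param) (auto simp: case_prod_beta intro!: continuous_intros cw ch)
next
  case (Suc k)
  have "partial i (\<lambda>x. integral (cbox a b) (\<lambda>y. w y * h (x - y))) =
      (\<lambda>x. integral (cbox a b) (\<lambda>y. w y * partial i h (x - y)))" for i
    by (rule ext, rule convolution_has_partials(2)[OF w Suc.prems])
  moreover have "Ck n (partial i h)" for n i using Suc.prems[of "Suc n"] by simp
  ultimately show ?case
    using Suc.IH convolution_has_partials(1)[OF w Suc.prems] by auto
qed

text \<open>This lets a derivative be moved between the factors: on \<open>g\<close> it shows that
  the mollification is smooth, on \<open>u\<close> it exhibits its partials as averages of the
  partials of \<open>u\<close>.\<close>

lemma convolution_commute:
  fixes u g :: "real^3 \<Rightarrow> real"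
  assumes u: "continuous_on UNIV u" and g: "continuous_on UNIV g"
    and su: "\<And>x. x \<notin> cbox a b \<Longrightarrow> u x = 0" and sg: "\<And>x. x \<notin> cbox c d \<Longrightarrow> g x = 0"
  shows "integral (cbox a b) (\<lambda>y. u y * g (x - y)) = integral (cbox c d) (\<lambda>z. g z * u (x - z))"
proof -
  have cu: "continuous_on A (\<lambda>z. u (k z))" if "continuous_on A k" for A and k :: "real^3 \<Rightarrow> real^3"
    using continuous_on_compose2[OF u that] by auto
  have cg: "continuous_on A (\<lambda>z. g (k z))" if "continuous_on A k" for A and k :: "real^3 \<Rightarrow> real^3"
    using continuous_on_compose2[OF g that] by auto
  have "((\<lambda>y. u y * g (x - y)) has_integral integral (cbox a b) (\<lambda>y. u y * g (x - y))) (cbox a b)"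
    by (intro integrable_integral integrable_continuous continuous_intros cu cg)
  \<comment> \<open>The substitution is \<open>y = x - z\<close>; its Jacobian factor is 1.\<close>
  from has_integral_affinity[OF this, of "-1" x]
  have "((\<lambda>z. u (x - z) * g z) has_integral integral (cbox a b) (\<lambda>y. u y * g (x - y)))
      ((\<lambda>z. x - z) ` cbox a b)"
    by simp
  then have "integral ((\<lambda>z. x - z) ` cbox a b) (\<lambda>z. g z * u (x - z)) =
      integral (cbox a b) (\<lambda>y. u y * g (x - y))"
    by (simp add: integral_unique mult.commute)
  \<comment> \<open>Each integrand vanishes off its own box, so both integrals equal the integral
    over the whole space and the different boxes do not matter.\<close>
  moreover have "(\<lambda>z. if z \<in> (\<lambda>z. x - z) ` cbox a b then g z * u (x - z) else 0) =
      (\<lambda>z. g z * u (x - z))"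
  proof
    fix z
    have "x - z \<notin> cbox a b" if "z \<notin> (\<lambda>z. x - z) ` cbox a b"
      using that by (metis diff_diff_eq2 add_diff_cancel_left' image_eqI)
    then show "(if z \<in> (\<lambda>z. x - z) ` cbox a b then g z * u (x - z) else 0) = g z * u (x - z)"
      using su by auto
  qed
  then have "integral ((\<lambda>z. x - z) ` cbox a b) (\<lambda>z. g z * u (x - z)) =
      integral UNIV (\<lambda>z. g z * u (x - z))"
    using integral_restrict_UNIV[of "(\<lambda>z. x - z) ` cbox a b" "\<lambda>z. g z * u (x - z)"] by simp
  moreover have "(\<lambda>z. if z \<in> cbox c d then g z * u (x - z) else 0) = (\<lambda>z. g z * u (x - z))"
    using sg by auto
  then have "integral (cbox c d) (\<lambda>z. g z * u (x - z)) = integral UNIV (\<lambda>z. g z * u (x - z))"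
    using integral_restrict_UNIV[of "cbox c d" "\<lambda>z. g z * u (x - z)"] by simp
  ultimately show ?thesis by simp
qed


text \<open>\<open>g\<close> is a probability density living where \<open>norm z < r\<close>, and an
  average stays within \<open>e\<close> of \<open>c\<close> if the averaged values do. With
  \<open>c = 0\<close> this gives uniform bounds, with small \<open>e\<close> convergence.\<close>

lemma smooth_kernel_average:
  fixes g w :: "real^3 \<Rightarrow> real"
  assumes g: "continuous_on UNIV g" "\<And>x. g x \<ge> 0" "\<And>x. norm x \<ge> r \<Longrightarrow> g x = 0"
      "(g has_integral 1) (cbox a b)"
    and w: "continuous_on UNIV w" "\<And>z. norm z < r \<Longrightarrow> \<bar>w z - c\<bar> \<le> e"
  shows "\<bar>integral (cbox a b) (\<lambda>z. g z * w z) - c\<bar> \<le> e"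
proof -
  have cg: "continuous_on (cbox a b) g" and cw: "continuous_on (cbox a b) w"
    using g(1) w(1) by (auto intro: continuous_on_subset)
  have "integral (cbox a b) (\<lambda>z. g z * (w z - c)) =
      integral (cbox a b) (\<lambda>z. g z * w z) - integral (cbox a b) g * c"
    by (simp add: right_diff_distrib integral_diff integrable_continuous continuous_intros cg cw)
  then have "integral (cbox a b) (\<lambda>z. g z * w z) - c = integral (cbox a b) (\<lambda>z. g z * (w z - c))"
    using g(4) by (simp add: integral_unique)
  also have "\<bar>\<dots>\<bar> \<le> integral (cbox a b) (\<lambda>z. g z * e)"
    unfolding real_norm_def[symmetric]
  proof (rule integral_norm_bound_integral)
    show "norm (g z * (w z - c)) \<le> g z * e" for z
      using g(2)[of z] g(3)[of z] w(2)[of z]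
      by (cases "norm z < r") (auto simp: abs_mult intro!: mult_left_mono)
  qed (intro integrable_continuous continuous_intros cg cw)+
  also have "\<dots> = e" using g(4) by (simp add: integral_unique)
  finally show ?thesis .
qed

lemma partial_eq_0_outside:
  assumes "\<And>x. norm x > R \<Longrightarrow> f x = 0" "norm x > R"
  shows "partial i f x = 0"
proof -
  have "open {x :: real^3. norm x > R}"
    by (intro open_Collect_less continuous_intros)
  then have "(f has_derivative (\<lambda>h. 0)) (at x)"
    using assms by (intro has_derivative_transform_within_open[OF has_derivative_const]) auto
  from has_derivative_partial[OF this] show ?thesis .
qed

lemma bounded_of_support_in_ball:
  fixes f :: "'a::euclidean_space \<Rightarrow> 'b::real_normed_vector"
  assumes "continuous_on UNIV f" "\<And>x. norm x > R \<Longrightarrow> f x = 0"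
  obtains B where "B \<ge> 0" "\<And>x. norm (f x) \<le> B"
proof -
  have "compact (f ` cball 0 R)"
    using assms(1) by (intro compact_continuous_image) (auto intro: continuous_on_subset)
  then obtain B where "\<And>y. y \<in> f ` cball 0 R \<Longrightarrow> norm y \<le> B"
    using compact_imp_bounded bounded_iff by metis
  \<comment> \<open>For negative \<open>R\<close> the ball is empty and \<open>B\<close> could be
    negative, hence the maximum with 0.\<close>
  then have "norm (f x) \<le> max B 0" for x
    using assms(2)[of x] by (cases "norm x \<le> R") (auto simp: le_max_iff_disj)
  then show ?thesis using that[of "max B 0"] by auto
qed

lemma test_functionI:
  assumes "\<And>k. Ck k f" "\<And>x. norm x > R \<Longrightarrow> f x = 0"
  shows "test_function f"
proof -
  have "{x. f x \<noteq> 0} \<subseteq> cball 0 R" using assms(2) by (force simp: not_less)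
  then have "bounded (closure {x. f x \<noteq> 0})"
    using bounded_closure bounded_subset bounded_cball by blast
  then show ?thesis using assms(1) by (auto simp: test_function_def compact_eq_bounded_closed)
qed

text \<open>Mollification with kernels of radius \<open>1 / (n + 1)\<close>. Radii at most 1 keep
  all supports in the ball of radius \<open>R + 1\<close>; the common bound \<open>B i\<close> and
  pointwise convergence of the partials are what dominated convergence will ask for.\<close>

lemma C1_approximation_by_test_functions:
  assumes u: "Ck (Suc 0) u" "\<And>x. norm x > R \<Longrightarrow> u x = 0"
  obtains U B where "\<And>n. test_function (U n)" "\<And>n x. norm x > R + 1 \<Longrightarrow> U n x = 0"
    "\<And>n i x. \<bar>partial i (U n) x\<bar> \<le> B i" "\<And>i x. (\<lambda>n. partial i (U n) x) \<longlonglongrightarrow> partial i u x"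
proof -
  define r where "r n = inverse (real (Suc n))" for n
  have r: "r n > 0" "r n \<le> 1" for n by (simp_all add: r_def field_simps)
  have "\<exists>g. (\<forall>k. Ck k g) \<and> (\<forall>x. g x \<ge> 0) \<and> (\<forall>x. norm x \<ge> r n \<longrightarrow> g x = 0) \<and>
      (g has_integral 1) (cbox (- vec (r n)) (vec (r n)))" for n
    using exists_smooth_kernel[OF r(1)[of n]] by metis
  then obtain g where g: "\<And>n k. Ck k (g n)" "\<And>n x. g n x \<ge> 0"
      "\<And>n x. norm x \<ge> r n \<Longrightarrow> g n x = 0"
      "\<And>n. (g n has_integral 1) (cbox (- vec (r n)) (vec (r n)))"
    by metis
  let ?Q = "\<lambda>R::real. cbox (- vec R) (vec R) :: (real^3) set"
  have outside: "norm x \<ge> R" if "x \<notin> ?Q R" for x R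
  proof -
    from that obtain i where "x $ i < - R \<or> R < x $ i"
      by (auto simp: mem_box_cart not_le)
    then show ?thesis using component_le_norm_cart[of x i] by linarith
  qed
  \<comment> \<open>The cube of half-width \<open>R + 1\<close> gives slack: \<open>outside\<close>
    yields only a weak inequality, whereas \<open>u\<close> is known to vanish where
    \<open>norm x > R\<close> strictly.\<close>
  define U where "U n x = integral (?Q (R + 1)) (\<lambda>y. u y * g n (x - y))" for n x
  have cu: "continuous_on UNIV u" using Ck_continuous_on[OF u(1)] .
  have cp: "continuous_on UNIV (partial i u)" for i using u(1) by simp
  have cg: "continuous_on UNIV (g n)" for n using Ck_continuous_on[OF g(1)] .
  have U_eq: "U n = (\<lambda>x. integral (?Q (r n)) (\<lambda>z. g n z * u (x - z)))" for n
  proof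
    fix x
    show "U n x = integral (?Q (r n)) (\<lambda>z. g n z * u (x - z))"
      unfolding U_def
    proof (rule convolution_commute[OF cu cg])
      show "u x = 0" if "x \<notin> ?Q (R + 1)" for x
        using outside[OF that] by (intro u(2)) linarith
      show "g n x = 0" if "x \<notin> ?Q (r n)" for x
        using outside[OF that] by (rule g(3))
    qed
  qed
  \<comment> \<open>Here the commuted form is differentiated, so the derivative hits
    \<open>u\<close> and one continuous derivative of \<open>u\<close> is enough.\<close>
  have partial_U: "partial i (U n) x = integral (?Q (r n)) (\<lambda>z. g n z * partial i u (x - z))" for i n x
    unfolding U_eq by (rule convolution_has_partials(2)[OF cg u(1)])
  have cps: "continuous_on UNIV (\<lambda>z. partial i u (x - z))" for i x
    by (rule continuous_on_compose2[OF cp]) (auto intro: continuous_intros)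
  have supp: "U n x = 0" if "norm x > R + 1" for n x
  proof -
    have "(\<lambda>z. g n z * u (x - z)) = (\<lambda>z. 0)"
    proof
      fix z
      show "g n z * u (x - z) = 0"
      proof (cases "norm z \<ge> r n")
        case False
        then have "norm (x - z) > R"
          using that r(2)[of n] norm_triangle_ineq2[of x z] by linarith
        then show ?thesis by (simp add: u(2))
      qed (simp add: g(3))
    qed
    then show ?thesis by (simp add: U_eq)
  qed
  have "\<exists>B. \<forall>x. \<bar>partial i u x\<bar> \<le> B" for i
  proof -
    have "partial i u x = 0" if "norm x > R" for x by (rule partial_eq_0_outside[OF u(2) that])
    from bounded_of_support_in_ball[OF cp[of i] this] show ?thesis by (metis real_norm_def)
  qed
  then obtain B where B: "\<And>i x. \<bar>partial i u x\<bar> \<le> B i" by metis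
  show thesis
  proof (rule that[of U B])
    show "test_function (U n)" for n
    proof (rule test_functionI[OF _ supp])
      show "Ck k (U n)" for k unfolding U_def by (rule Ck_convolution[OF cu g(1)])
    qed
    show "U n x = 0" if "norm x > R + 1" for n x using supp[OF that] .
    show "\<bar>partial i (U n) x\<bar> \<le> B i" for n i x
    proof -
      have "\<bar>integral (?Q (r n)) (\<lambda>z. g n z * partial i u (x - z)) - 0\<bar> \<le> B i"
        using B by (intro smooth_kernel_average[OF cg g(2) g(3) g(4) cps]) auto
      then show ?thesis by (simp add: partial_U)
    qed
    show "(\<lambda>n. partial i (U n) x) \<longlonglongrightarrow> partial i u x" for i x
    proof (rule LIMSEQ_I)
      fix e :: real assume "e > 0"
      then obtain d where d: "d > 0" "\<And>y. dist y x < d \<Longrightarrow> dist (partial i u y) (partial i u x) < e / 2"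
        using cp[of i] unfolding continuous_on_iff by (metis UNIV_I half_gt_zero)
      obtain N where N: "r N < d" using reals_Archimedean[OF d(1)] by (auto simp: r_def)
      have "norm (partial i (U n) x - partial i u x) < e" if "n \<ge> N" for n
      proof -
        have "r n \<le> r N" using that by (simp add: r_def field_simps)
        then have "\<bar>partial i u (x - z) - partial i u x\<bar> \<le> e / 2" if "norm z < r n" for z
          using d(2)[of "x - z"] that N by (auto simp: dist_norm)
        then have "\<bar>partial i (U n) x - partial i u x\<bar> \<le> e / 2"
          unfolding partial_U by (intro smooth_kernel_average[OF cg g(2) g(3) g(4) cps])
        then show ?thesis using \<open>e > 0\<close> by simp
      qed
      then show "\<exists>N. \<forall>n\<ge>N. norm (partial i (U n) x - partial i u x) < e" by blast
    qed
  qed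
qed


subsection \<open>Growth and confinement of trajectories\<close>

lemma has_vector_derivative_norm_bound:
  assumes "convex S" "\<And>x. x \<in> S \<Longrightarrow> (f has_vector_derivative f' x) (at x within S)"
    and "\<And>x. x \<in> S \<Longrightarrow> norm (f' x) \<le> B" "x \<in> S" "y \<in> S"
  shows "norm (f x - f y) \<le> B * \<bar>x - y\<bar>"
proof -
  have "norm (f x - f y) \<le> B * norm (x - y)"
  proof (rule differentiable_bound[OF assms(1) _ _ assms(4,5)])
    show "(f has_derivative (\<lambda>h. h *\<^sub>R f' x)) (at x within S)" if "x \<in> S" for x
      using assms(2)[OF that] by (simp add: has_vector_derivative_def)
    show "onorm (\<lambda>h. h *\<^sub>R f' x) \<le> B" if "x \<in> S" for x
      using assms(3)[OF that] by (intro onorm_le) (simp add: mult.commute[of B] mult_left_mono)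
  qed
  then show ?thesis by simp
qed

text \<open>Time reversal of an interval onto itself, used to deduce backward estimates from forward
  ones.\<close>

lemma has_vector_derivative_reflect:
  assumes "(f has_vector_derivative D) (at (a + b - x) within {a..b})"
  shows "((\<lambda>x. f (a + b - x)) has_vector_derivative - D) (at x within {a..b::real})"
proof -
  have "(\<lambda>x. a + b - x) ` {a..b} = {a..b}"
    by (auto intro!: image_eqI[of _ _ "a + b - _"])
  then have "(f \<circ> (\<lambda>x. a + b - x) has_vector_derivative (-1) *\<^sub>R D) (at x within {a..b})"
    using assms by (intro vector_diff_chain_within) (auto intro!: derivative_eq_intros)
  then show ?thesis by (simp add: o_def)
qed

text \<open>The function \<open>exp (- 2 C x) |f x|^2\<close> has nonpositive derivative by
  Cauchy-Schwarz. The square is used because the norm itself need not be differentiable where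
  \<open>f\<close> vanishes.\<close>

lemma norm_le_exp_growth_forward:
  fixes f :: "real \<Rightarrow> 'a::real_inner"
  assumes "a \<le> b"
    and f: "\<And>x. x \<in> {a..b} \<Longrightarrow> (f has_vector_derivative f' x) (at x within {a..b})"
    and bd: "\<And>x. x \<in> {a..b} \<Longrightarrow> norm (f' x) \<le> C * norm (f x)"
  shows "norm (f b) \<le> exp (C * (b - a)) * norm (f a)"
proof -
  define g where "g x = exp (- (2 * C * x)) * (f x \<bullet> f x)" for x
  define g' where "g' x = exp (- (2 * C * x)) * (2 * (f x \<bullet> f' x) - 2 * C * (f x \<bullet> f x))" for x
  have d: "(g has_real_derivative g' x) (at x within {a..b})" if "x \<in> {a..b}" for x
  proof -
    have "((\<lambda>x. f x \<bullet> f x) has_real_derivative 2 * (f x \<bullet> f' x)) (at x within {a..b})"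
      using has_derivative_inner[OF f[OF that, unfolded has_vector_derivative_def]
          f[OF that, unfolded has_vector_derivative_def]]
      by (simp add: has_field_derivative_def inner_commute[of "f' x"] mult_commute_abs algebra_simps)
    then show ?thesis unfolding g_def g'_def
      by (auto intro!: derivative_eq_intros simp: algebra_simps)
  qed
  have "g b \<le> g a"
  proof (rule DERIV_nonpos_imp_decreasing_open[OF \<open>a \<le> b\<close>])
    fix x assume x: "a < x" "x < b"
    have "(g has_real_derivative g' x) (at x)"
      using d[of x] x by (simp add: at_within_Icc_at)
    moreover have "f x \<bullet> f' x \<le> norm (f x) * (C * norm (f x))"
      using x by (intro order_trans[OF norm_cauchy_schwarz] mult_left_mono bd) auto
    then have "g' x \<le> 0"
      by (simp add: g'_def mult_le_0_iff power2_norm_eq_inner[symmetric] power2_eq_square mult_ac)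
    ultimately show "\<exists>y. (g has_real_derivative y) (at x) \<and> y \<le> 0" by blast
  next
    show "continuous_on {a..b} g" using d by (rule DERIV_continuous_on)
  qed
  then have "exp (2 * C * b) * g b \<le> exp (2 * C * b) * g a" by simp
  moreover have "exp (2 * C * b) * g x = exp (2 * C * (b - x)) * (norm (f x))\<^sup>2" for x
  proof -
    have "exp (2 * C * b) * exp (- (2 * C * x)) = exp (2 * C * (b - x))"
      by (simp add: exp_add[symmetric] right_diff_distrib)
    then show ?thesis by (simp add: g_def power2_norm_eq_inner mult.assoc[symmetric])
  qed
  ultimately have "(norm (f b))\<^sup>2 \<le> exp (2 * C * (b - a)) * (norm (f a))\<^sup>2" by simp
  also have "exp (2 * C * (b - a)) * (norm (f a))\<^sup>2 = (exp (C * (b - a)) * norm (f a))\<^sup>2"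
    by (simp add: power_mult_distrib exp_double[symmetric] mult.assoc)
  finally show ?thesis by (rule power2_le_imp_le) simp
qed

text \<open>Symmetric in \<open>x\<close> and \<open>y\<close>: values before and after a reference
  time are bounded by the value at that time, with one constant for the whole interval.\<close>

lemma norm_le_exp_growth:
  fixes f :: "real \<Rightarrow> 'a::real_inner"
  assumes f: "\<And>x. x \<in> {a..b} \<Longrightarrow> (f has_vector_derivative f' x) (at x within {a..b})"
    and bd: "\<And>x. x \<in> {a..b} \<Longrightarrow> norm (f' x) \<le> C * norm (f x)"
    and C: "C \<ge> 0" and xy: "x \<in> {a..b}" "y \<in> {a..b}"
  shows "norm (f y) \<le> exp (C * (b - a)) * norm (f x)"
proof -
  have sub: "(f has_vector_derivative f' z) (at z within {c..d})" if "z \<in> {c..d}" "{c..d} \<subseteq> {a..b}" for z c d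
    by (rule has_vector_derivative_within_subset[OF f]) (use that in auto)
  have "norm (f y) \<le> exp (C * \<bar>y - x\<bar>) * norm (f x)"
  proof (cases "x \<le> y")
    case True
    then have "{x..y} \<subseteq> {a..b}" using xy by auto
    with True show ?thesis
      using norm_le_exp_growth_forward[of x y f f' C] sub bd by (auto simp: subset_iff)
  next
    case False
    then have *: "{y..x} \<subseteq> {a..b}" using xy by auto
    \<comment> \<open>The reflected function \<open>f (y + x - z)\<close> starts at
      \<open>f x\<close> and ends at \<open>f y\<close>, so the forward estimate runs from
      \<open>x\<close> back to \<open>y\<close>.\<close>
    have "norm (f (y + x - x)) \<le> exp (C * (x - y)) * norm (f (y + x - y))"
    proof (rule norm_le_exp_growth_forward[where f = "\<lambda>z. f (y + x - z)" and f' = "\<lambda>z. - f' (y + x - z)"])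
      fix z assume z: "z \<in> {y..x}"
      then have "y + x - z \<in> {y..x}" by auto
      then show "((\<lambda>z. f (y + x - z)) has_vector_derivative - f' (y + x - z)) (at z within {y..x})"
        using * by (intro has_vector_derivative_reflect sub)
      show "norm (- f' (y + x - z)) \<le> C * norm (f (y + x - z))"
        using bd[of "y + x - z"] * \<open>y + x - z \<in> {y..x}\<close> by auto
    qed (use False in simp)
    then show ?thesis using False by (simp add: abs_if)
  qed
  also have "\<dots> \<le> exp (C * (b - a)) * norm (f x)"
    using xy C by (intro mult_right_mono) (auto intro!: mult_left_mono)
  finally show ?thesis .
qed

text \<open>A first-exit argument. The speed bound is available only inside the larger ball; until
  the first arrival at its boundary it applies, and the distance covered is then below 1, too little
  to get from radius \<open>R\<close> to \<open>R + 1\<close>.\<close>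

lemma trajectory_confined_forward:
  fixes q :: "real \<Rightarrow> 'a::real_normed_vector"
  assumes q: "\<And>x. x \<in> {a..b} \<Longrightarrow> (q has_vector_derivative q' x) (at x within {a..b})"
    and bd: "\<And>x. x \<in> {a..b} \<Longrightarrow> norm (q x) \<le> R + 1 \<Longrightarrow> norm (q' x) \<le> M"
    and M: "M * (b - a) < 1" "M \<ge> 0" and qa: "norm (q a) \<le> R" and x: "x \<in> {a..b}"
  shows "norm (q x) \<le> R + 1"
proof (rule ccontr)
  assume "\<not> norm (q x) \<le> R + 1"
  have cont: "continuous_on {a..b} (\<lambda>x. norm (q x))"
    unfolding continuous_on_eq_continuous_within
    by (intro ballI continuous_norm has_vector_derivative_continuous[OF q])
  \<comment> \<open>The times on the sphere of radius \<open>R + 1\<close>. By the intermediate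
    value theorem an escape forces such a time, and compactness gives a first one.\<close>
  define Z where "Z = {a..b} \<inter> (\<lambda>x. norm (q x)) -` {R + 1}"
  have hit: "\<exists>z\<in>Z. z \<le> y" if "y \<in> {a..b}" "norm (q y) > R + 1" for y
  proof -
    have "continuous_on {a..y} (\<lambda>x. norm (q x))"
      by (rule continuous_on_subset[OF cont]) (use that in auto)
    then have "\<exists>z. a \<le> z \<and> z \<le> y \<and> norm (q z) = R + 1"
      using that qa by (intro IVT') simp_all
    then obtain z where "a \<le> z" "z \<le> y" "norm (q z) = R + 1" by blast
    moreover have "z \<in> {a..b}" using that calculation by simp
    ultimately have "z \<in> Z" unfolding Z_def by simp
    with \<open>z \<le> y\<close> show ?thesis by blast
  qed
  have "closed Z" unfolding Z_def by (rule continuous_closed_preimage[OF cont]) simp_all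
  moreover have "bounded Z" by (rule bounded_subset[of "{a..b}"]) (simp_all add: Z_def)
  ultimately have "compact Z" by (simp add: compact_eq_bounded_closed)
  moreover have "Z \<noteq> {}" using hit[of x] x \<open>\<not> norm (q x) \<le> R + 1\<close> by auto
  ultimately obtain z where z: "z \<in> Z" "\<And>y. y \<in> Z \<Longrightarrow> z \<le> y"
    using compact_attains_inf by metis
  have zab: "z \<in> {a..b}" "norm (q z) = R + 1" using z(1) by (auto simp: Z_def)
  \<comment> \<open>Being outside before \<open>z\<close> would force a still earlier time in
    \<open>Z\<close>.\<close>
  have le: "norm (q y) \<le> R + 1" if y: "y \<in> {a..z}" for y
  proof (rule ccontr)
    assume "\<not> ?thesis"
    then obtain w where "w \<in> Z" "w \<le> y" using hit[of y] y zab by auto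
    then have "y = z" using z(2)[of w] y by auto
    with \<open>\<not> ?thesis\<close> zab show False by simp
  qed
  have "norm (q z - q a) \<le> M * \<bar>z - a\<bar>"
  proof (rule has_vector_derivative_norm_bound[of "{a..z}"])
    fix y assume y: "y \<in> {a..z}"
    then show "(q has_vector_derivative q' y) (at y within {a..z})"
      using q[of y] zab by (auto intro: has_vector_derivative_within_subset)
    show "norm (q' y) \<le> M" using bd[of y] le[OF y] y zab by auto
  qed (use zab in auto)
  also have "\<dots> \<le> M * (b - a)" using zab M by (intro mult_left_mono) auto
  finally have "norm (q z - q a) < 1" using M by simp
  then show False using zab qa norm_triangle_ineq2[of "q z" "q a"] by simp
qed

text \<open>The reference time \<open>c\<close> may lie anywhere in the interval; times before it
  are reached by reflecting the trajectory.\<close>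

lemma trajectory_confined:
  fixes q :: "real \<Rightarrow> 'a::real_normed_vector"
  assumes q: "\<And>x. x \<in> {a..b} \<Longrightarrow> (q has_vector_derivative q' x) (at x within {a..b})"
    and bd: "\<And>x. x \<in> {a..b} \<Longrightarrow> norm (q x) \<le> R + 1 \<Longrightarrow> norm (q' x) \<le> M"
    and M: "M * (b - a) < 1" "M \<ge> 0" and c: "c \<in> {a..b}" "norm (q c) \<le> R" and x: "x \<in> {a..b}"
  shows "norm (q x) \<le> R + 1"
proof -
  have sub: "(q has_vector_derivative q' z) (at z within {u..w})" if "z \<in> {u..w}" "{u..w} \<subseteq> {a..b}" for z u w
    by (rule has_vector_derivative_within_subset[OF q]) (use that in auto)
  have len: "M * (w - u) < 1" if "u \<in> {a..b}" "w \<in> {a..b}" for u w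
    using that M by (intro le_less_trans[OF _ M(1)] mult_left_mono) auto
  show ?thesis
  proof (cases "c \<le> x")
    case True
    show ?thesis
    proof (rule trajectory_confined_forward[of c x q q' R M])
      show "(q has_vector_derivative q' y) (at y within {c..x})" if "y \<in> {c..x}" for y
        using sub[OF that] c x by auto
    qed (use True c x bd M len in auto)
  next
    case False
    have *: "x + c - y \<in> {x..c}" "x + c - y \<in> {a..b}" if "y \<in> {x..c}" for y using that c x by auto
    have "norm (q (x + c - c)) \<le> R + 1"
    proof (rule trajectory_confined_forward[where q = "\<lambda>y. q (x + c - y)"
          and q' = "\<lambda>y. - q' (x + c - y)" and a = x and b = c and M = M])
      show "((\<lambda>y. q (x + c - y)) has_vector_derivative - q' (x + c - y)) (at y within {x..c})"
        if "y \<in> {x..c}" for y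
        using * that c x by (intro has_vector_derivative_reflect sub) auto
      show "norm (- q' (x + c - y)) \<le> M" if "y \<in> {x..c}" "norm (q (x + c - y)) \<le> R + 1" for y
        using bd[of "x + c - y"] * that by auto
    qed (use False c x M len in auto)
    then show ?thesis by simp
  qed
qed

section \<open>Localisation in time\<close>

text \<open>Replaces \<open>T\<close> by a short compact interval without changing derivatives at
  \<open>t\<close>, also when \<open>t\<close> is an end point of \<open>T\<close> or its only
  point. Compactness provides uniform bounds on \<open>v\<close>, shortness provides
  confinement.\<close>

lemma interval_neighbourhood:
  fixes T :: "real set"
  assumes T: "is_interval T" "t \<in> T" and "d > 0"
  obtains a b where "a \<le> t" "t \<le> b" "{a..b} \<subseteq> T" "b - a \<le> d" "at t within T = at t within {a..b}"
proof -
  have between: "y \<in> T" if "x \<in> T" "x' \<in> T" "x \<le> y" "y \<le> x'" for x x' y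
    using T(1) that unfolding is_interval_1 by blast
  \<comment> \<open>The left end coincides with \<open>t\<close> only if \<open>T\<close> has no
    points to the left of \<open>t\<close>; otherwise it must lie strictly before \<open>t\<close>
    to keep the filter unchanged. The right end is symmetric.\<close>
  have "\<exists>a\<in>T. a \<le> t \<and> t - d / 2 \<le> a \<and> (a < t \<or> (\<forall>x\<in>T. t \<le> x))"
  proof (cases "\<exists>x\<in>T. x < t")
    case True
    then obtain x where x: "x \<in> T" "x < t" by blast
    then have "max x (t - d / 2) \<in> T"
      using \<open>d > 0\<close> by (intro between[OF x(1) T(2)]) simp_all
    then show ?thesis using x(2) \<open>d > 0\<close> by (intro bexI[of _ "max x (t - d / 2)"]) simp_all
  next
    case False
    then show ?thesis using T(2) \<open>d > 0\<close> by (intro bexI[of _ t]) (simp_all add: not_less)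
  qed
  then obtain a where a: "a \<in> T" "a \<le> t" "t - d / 2 \<le> a" "a < t \<or> (\<forall>x\<in>T. t \<le> x)" by blast
  have "\<exists>b\<in>T. t \<le> b \<and> b \<le> t + d / 2 \<and> (t < b \<or> (\<forall>x\<in>T. x \<le> t))"
  proof (cases "\<exists>x\<in>T. t < x")
    case True
    then obtain x where x: "x \<in> T" "t < x" by blast
    then have "min x (t + d / 2) \<in> T"
      using \<open>d > 0\<close> by (intro between[OF T(2) x(1)]) simp_all
    then show ?thesis using x(2) \<open>d > 0\<close> by (intro bexI[of _ "min x (t + d / 2)"]) simp_all
  next
    case False
    then show ?thesis using T(2) \<open>d > 0\<close> by (intro bexI[of _ t]) (simp_all add: not_less)
  qed
  then obtain b where b: "b \<in> T" "t \<le> b" "b \<le> t + d / 2" "t < b \<or> (\<forall>x\<in>T. x \<le> t)" by blast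
  have sub: "{a..b} \<subseteq> T" using between[OF a(1) b(1)] by auto
  \<comment> \<open>An open neighbourhood of \<open>t\<close> that is cut off only on those sides
    where the chosen interval extends beyond \<open>t\<close>.\<close>
  define S where "S = (if a < t then {a<..} else UNIV) \<inter> (if t < b then {..<b} else UNIV)"
  have "at t within T = at t within {a..b}"
  proof (rule at_within_nhd[of t S])
    have "x \<in> {a..b}" if "x \<in> T" "x \<in> S" for x
    proof -
      have "a \<le> x" using a(4) that by (cases "a < t") (auto simp: S_def intro: order_trans[OF a(2)])
      moreover have "x \<le> b" using b(4) that by (cases "t < b") (auto simp: S_def intro: order_trans[OF _ b(2)])
      ultimately show ?thesis by simp
    qed
    with sub show "T \<inter> S - {t} = {a..b} \<inter> S - {t}" by blast
  qed (auto simp: S_def)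
  then show thesis using a(3) b(3) by (intro that[OF a(2) b(2) sub]) auto
qed


subsection \<open>Pairings with locally finite singular fields\<close>

text \<open>One summand of the singular field at one time, over an abstract measure in place of
  \<open>lebesgue_on (S a)\<close>.\<close>

definition locally_finite_pairing ::
    "'s measure \<Rightarrow> ('s \<Rightarrow> real^3) \<Rightarrow> ('s \<Rightarrow> real^3) \<Rightarrow> bool" where
  "locally_finite_pairing M p q \<longleftrightarrow> p \<in> borel_measurable M \<and> q \<in> borel_measurable M \<and>
     (\<forall>K. compact K \<longrightarrow> integrable M (\<lambda>s. indicat_real K (q s) *\<^sub>R p s))"

lemma pairing_measurable:
  assumes "locally_finite_pairing M p q" "continuous_on UNIV \<Psi>"
  shows "(\<lambda>s. p s \<bullet> \<Psi> (q s)) \<in> borel_measurable M"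
proof -
  have "\<Psi> \<in> borel_measurable borel" using assms(2) by (rule borel_measurable_continuous_onI)
  then have "(\<lambda>s. \<Psi> (q s)) \<in> borel_measurable M"
    using assms(1) measurable_compose[of q M borel \<Psi> borel] by (simp add: locally_finite_pairing_def)
  then show ?thesis using assms(1) by (auto simp: locally_finite_pairing_def)
qed

text \<open>Turns the support of \<open>\<Psi>\<close> into an indicator on \<open>p\<close>, the
  form in which local finiteness supplies integrability.\<close>

lemma pairing_bound:
  fixes y z :: "real^3"
  assumes "\<And>x. norm x > R \<Longrightarrow> \<Psi> x = 0" "\<And>x. norm (\<Psi> x) \<le> B"
  shows "norm (y \<bullet> \<Psi> z) \<le> B * norm (indicat_real (cball 0 R) z *\<^sub>R y)"
proof (cases "norm z \<le> R")
  case True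
  have "norm (y \<bullet> \<Psi> z) \<le> norm y * norm (\<Psi> z)" by (simp add: Cauchy_Schwarz_ineq2)
  also have "\<dots> \<le> norm y * B" using assms(2) by (intro mult_left_mono) auto
  finally show ?thesis using True by (simp add: mult.commute)
next
  case False
  then show ?thesis using assms(1)[of z] by simp
qed

lemma pairing_integrable:
  assumes M: "locally_finite_pairing M p q" and \<Psi>: "continuous_on UNIV \<Psi>" "\<And>x. norm x > R \<Longrightarrow> \<Psi> x = 0"
  shows "integrable M (\<lambda>s. p s \<bullet> \<Psi> (q s))"
proof -
  obtain B where B: "B \<ge> 0" "\<And>x. norm (\<Psi> x) \<le> B" using bounded_of_support_in_ball[OF \<Psi>] by blast
  show ?thesis
  proof (rule Bochner_Integration.integrable_bound)
    show "integrable M (\<lambda>s. B * norm (indicat_real (cball 0 R) (q s) *\<^sub>R p s))"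
      using M unfolding locally_finite_pairing_def
      by (intro integrable_mult_right integrable_norm) (auto intro: compact_cball)
    show "AE s in M. norm (p s \<bullet> \<Psi> (q s)) \<le> norm (B * norm (indicat_real (cball 0 R) (q s) *\<^sub>R p s))"
    proof (rule AE_I2)
      fix s
      have "norm (p s \<bullet> \<Psi> (q s)) \<le> B * norm (indicat_real (cball 0 R) (q s) *\<^sub>R p s)"
        by (rule pairing_bound[OF \<Psi>(2) B(2)])
      then show "norm (p s \<bullet> \<Psi> (q s)) \<le> norm (B * norm (indicat_real (cball 0 R) (q s) *\<^sub>R p s))"
        by (rule order_trans) simp
    qed
  qed (rule pairing_measurable[OF M \<Psi>(1)])
qed

lemma pairing_tendsto:
  assumes M: "locally_finite_pairing M p q"
    and \<Psi>: "\<And>n. continuous_on UNIV (\<Psi> n)" "\<And>n x. norm x > R \<Longrightarrow> \<Psi> n x = 0"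
      "\<And>n x. norm (\<Psi> n x) \<le> B"
    and lim: "\<And>x. (\<lambda>n. \<Psi> n x) \<longlonglongrightarrow> \<Phi> x"
  shows "(\<lambda>n. LINT s|M. p s \<bullet> \<Psi> n (q s)) \<longlonglongrightarrow> (LINT s|M. p s \<bullet> \<Phi> (q s))"
proof (rule integral_dominated_convergence)
  have lim': "(\<lambda>n. p s \<bullet> \<Psi> n (q s)) \<longlonglongrightarrow> p s \<bullet> \<Phi> (q s)" for s
    by (intro tendsto_inner tendsto_const lim)
  then show "AE s in M. (\<lambda>n. p s \<bullet> \<Psi> n (q s)) \<longlonglongrightarrow> p s \<bullet> \<Phi> (q s)" by simp
  show meas: "(\<lambda>s. p s \<bullet> \<Psi> n (q s)) \<in> borel_measurable M" for n
    by (rule pairing_measurable[OF M \<Psi>(1)])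
  \<comment> \<open>Measurability of the limit is inherited from the sequence, as convergence holds
    for every \<open>s\<close>.\<close>
  show "(\<lambda>s. p s \<bullet> \<Phi> (q s)) \<in> borel_measurable M"
    by (rule borel_measurable_LIMSEQ_real[OF lim' meas])
  show "integrable M (\<lambda>s. B * norm (indicat_real (cball 0 R) (q s) *\<^sub>R p s))"
    using M unfolding locally_finite_pairing_def
    by (intro integrable_mult_right integrable_norm) (auto intro: compact_cball)
  show "AE s in M. norm (p s \<bullet> \<Psi> n (q s)) \<le> B * norm (indicat_real (cball 0 R) (q s) *\<^sub>R p s)" for n
    by (rule AE_I2) (rule pairing_bound[OF \<Psi>(2,3)])
qed

lemma locally_finite_singularD:
  assumes "locally_finite_singular N S p q T" "a \<le> N" "t \<in> T"
  shows "locally_finite_pairing (lebesgue_on (S a)) (\<lambda>s. p a s t) (\<lambda>s. q a s t)"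
  using assms by (simp add: locally_finite_singular_def locally_finite_pairing_def)

lemma singular_field_tendsto:
  assumes M: "locally_finite_singular N S p q T" "t \<in> T"
    and \<Psi>: "\<And>n. continuous_on UNIV (\<Psi> n)" "\<And>n x. norm x > R \<Longrightarrow> \<Psi> n x = 0"
      "\<And>n x. norm (\<Psi> n x) \<le> B" "\<And>x. (\<lambda>n. \<Psi> n x) \<longlonglongrightarrow> \<Phi> x"
  shows "(\<lambda>n. singular_field N S p q t (\<Psi> n)) \<longlonglongrightarrow> singular_field N S p q t \<Phi>"
  unfolding singular_field_def using locally_finite_singularD[OF M(1) _ M(2)]
  by (intro tendsto_sum pairing_tendsto[OF _ \<Psi>]) auto

lemma singular_field_add:
  assumes M: "locally_finite_singular N S p q T" "t \<in> T"
    and \<Psi>: "continuous_on UNIV \<Psi>" "\<And>x. norm x > R \<Longrightarrow> \<Psi> x = 0"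
    and \<Phi>: "continuous_on UNIV \<Phi>" "\<And>x. norm x > R \<Longrightarrow> \<Phi> x = 0"
  shows "singular_field N S p q t (\<lambda>x. \<Psi> x + \<Phi> x) =
    singular_field N S p q t \<Psi> + singular_field N S p q t \<Phi>"
proof -
  have "(LINT s|lebesgue_on (S a). p a s t \<bullet> (\<Psi> (q a s t) + \<Phi> (q a s t))) =
      (LINT s|lebesgue_on (S a). p a s t \<bullet> \<Psi> (q a s t)) +
      (LINT s|lebesgue_on (S a). p a s t \<bullet> \<Phi> (q a s t))" if "a \<le> N" for a
    using locally_finite_singularD[OF M(1) that M(2)]
    by (simp add: inner_add_right Bochner_Integration.integral_add
        pairing_integrable[OF _ \<Psi>] pairing_integrable[OF _ \<Phi>])
  then show ?thesis by (simp add: singular_field_def sum.distrib)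
qed

subsection \<open>Closedness tested against fields of class C1\<close>

lemma continuous_on_componentwise_cart:
  fixes f :: "'a::topological_space \<Rightarrow> real^'n"
  assumes "\<And>i. continuous_on A (\<lambda>x. f x $ i)"
  shows "continuous_on A f"
proof -
  have "continuous_on A (\<lambda>x. \<chi> i. f x $ i)" by (rule continuous_on_vec_lambda[OF assms])
  then show ?thesis by simp
qed

definition C1_field :: "(real^3 \<Rightarrow> real^3) \<Rightarrow> bool" where
  "C1_field w \<longleftrightarrow> (\<forall>i. Ck (Suc 0) (\<lambda>x. w x $ i))"

lemma C1_field_partial_continuous:
  "C1_field w \<Longrightarrow> continuous_on A (partial i (\<lambda>x. w x $ j))"
  by (auto simp: C1_field_def intro: continuous_on_subset)

lemma C1_field_component_differentiable:
  "C1_field w \<Longrightarrow> (\<lambda>x. w x $ j) differentiable (at x)"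
  by (auto simp: C1_field_def)

lemma C1_field_continuous: "C1_field w \<Longrightarrow> continuous_on A w"
  by (intro continuous_on_componentwise_cart Ck_continuous_on[of "Suc 0"]) (auto simp: C1_field_def)

lemma continuous_on_grad: "Ck (Suc 0) f \<Longrightarrow> continuous_on A (grad f)"
  by (intro continuous_on_componentwise_cart) (auto simp: grad_def intro: continuous_on_subset)

lemma continuous_on_curl: "C1_field w \<Longrightarrow> continuous_on A (curl w)"
proof (rule continuous_on_componentwise_cart)
  assume w: "C1_field w"
  have "\<forall>i. continuous_on A (\<lambda>x. curl w x $ i)"
    unfolding forall_3 curl_def vector_3 by (intro conjI continuous_on_diff C1_field_partial_continuous w)
  then show "continuous_on A (\<lambda>x. curl w x $ i)" for i by blast
qed

text \<open>The entrywise l1 norm of the Jacobian. It bounds curl, divergence and both contractions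
  with constant 1, and is continuous as soon as the partials are.\<close>

definition jac_norm :: "(real^3 \<Rightarrow> real^3) \<Rightarrow> real^3 \<Rightarrow> real" where
  "jac_norm w x = (\<Sum>i\<in>UNIV. \<Sum>j\<in>UNIV. \<bar>partial i (\<lambda>y. w y $ j) x\<bar>)"

lemma norm_curl_le: "norm (curl w x) \<le> jac_norm w x"
proof -
  have "norm (curl w x) \<le> (\<Sum>i\<in>UNIV. \<bar>curl w x $ i\<bar>)" by (rule norm_le_l1_cart)
  also have "\<dots> \<le> (\<bar>partial 2 (\<lambda>y. w y $ 3) x\<bar> + \<bar>partial 3 (\<lambda>y. w y $ 2) x\<bar>) +
      (\<bar>partial 3 (\<lambda>y. w y $ 1) x\<bar> + \<bar>partial 1 (\<lambda>y. w y $ 3) x\<bar>) +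
      (\<bar>partial 1 (\<lambda>y. w y $ 2) x\<bar> + \<bar>partial 2 (\<lambda>y. w y $ 1) x\<bar>)"
    unfolding sum_3 curl_def vector_3 by (intro add_mono abs_triangle_ineq4)
  also have "\<dots> \<le> jac_norm w x" by (simp add: sum_3 jac_norm_def)
  finally show ?thesis .
qed

text \<open>Mollifying each component gives test fields whose curls converge pointwise with common
  bound and support. Their pairings vanish by closedness, hence so does the limit.\<close>

lemma closed_one_form_C1_field:
  assumes M: "locally_finite_singular N S p q T" "t \<in> T"
    and closed: "closed_one_form (singular_field N S p q t)"
    and w: "C1_field w" "\<And>x. norm x > R \<Longrightarrow> w x = 0"
  shows "singular_field N S p q t (curl w) = 0"
proof -
  have "\<exists>U B. (\<forall>n. test_function (U n)) \<and> (\<forall>n x. norm x > R + 1 \<longrightarrow> U n x = 0) \<and>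
      (\<forall>n i x. \<bar>partial i (U n) x\<bar> \<le> B i) \<and>
      (\<forall>i x. (\<lambda>n. partial i (U n) x) \<longlonglongrightarrow> partial i (\<lambda>x. w x $ j) x)" for j
  proof -
    have "Ck (Suc 0) (\<lambda>x. w x $ j)" "\<And>x. norm x > R \<Longrightarrow> w x $ j = 0"
      using w unfolding C1_field_def by auto
    from C1_approximation_by_test_functions[OF this] show ?thesis by metis
  qed
  then obtain U B where U: "\<And>j n. test_function (U j n)" "\<And>j n x. norm x > R + 1 \<Longrightarrow> U j n x = 0"
      "\<And>j n i x. \<bar>partial i (U j n) x\<bar> \<le> B j i"
      "\<And>j i x. (\<lambda>n. partial i (U j n) x) \<longlonglongrightarrow> partial i (\<lambda>x. w x $ j) x"
    by metis
  define W where "W n x = (\<chi> j. U j n x)" for n x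
  have W_nth: "(\<lambda>x. W n x $ j) = U j n" for n j by (simp add: W_def fun_eq_iff)
  have CW: "C1_field (W n)" for n
    using U(1) unfolding C1_field_def W_nth test_function_def by blast
  have "(\<lambda>n. singular_field N S p q t (curl (W n))) \<longlonglongrightarrow> singular_field N S p q t (curl w)"
  proof (rule singular_field_tendsto[OF M])
    show "continuous_on UNIV (curl (W n))" for n by (rule continuous_on_curl[OF CW])
    show "curl (W n) x = 0" if "norm x > R + 1" for n x
      using partial_eq_0_outside[OF U(2) that] by (simp add: curl_def W_nth vec_eq_iff forall_3)
    show "norm (curl (W n) x) \<le> (\<Sum>i\<in>UNIV. \<Sum>j\<in>UNIV. B j i)" for n x
      using U(3) by (intro order_trans[OF norm_curl_le]) (auto simp: jac_norm_def W_nth intro!: sum_mono)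
    show "(\<lambda>n. curl (W n) x) \<longlonglongrightarrow> curl w x" for x
    proof (rule vec_tendstoI)
      have "\<forall>i. (\<lambda>n. curl (W n) x $ i) \<longlonglongrightarrow> curl w x $ i"
        unfolding forall_3 curl_def vector_3 W_nth by (intro conjI tendsto_diff U(4))
      then show "(\<lambda>n. curl (W n) x $ i) \<longlonglongrightarrow> curl w x $ i" for i by blast
    qed
  qed
  moreover have "singular_field N S p q t (curl (W n)) = 0" for n
    using closed U(1) by (simp add: closed_one_form_def dist_curl_def test_field_def W_nth)
  ultimately show ?thesis by (simp add: LIMSEQ_const_iff)
qed

lemma closed_two_form_C1:
  assumes M: "locally_finite_singular N S p q T" "t \<in> T"
    and closed: "closed_two_form (singular_field N S p q t)"
    and f: "Ck (Suc 0) f" "\<And>x. norm x > R \<Longrightarrow> f x = 0"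
  shows "singular_field N S p q t (grad f) = 0"
proof -
  obtain U B where U: "\<And>n. test_function (U n)" "\<And>n x. norm x > R + 1 \<Longrightarrow> U n x = 0"
    "\<And>n i x. \<bar>partial i (U n) x\<bar> \<le> B i" "\<And>i x. (\<lambda>n. partial i (U n) x) \<longlonglongrightarrow> partial i f x"
    using C1_approximation_by_test_functions[OF f] by blast
  have "(\<lambda>n. singular_field N S p q t (grad (U n))) \<longlonglongrightarrow> singular_field N S p q t (grad f)"
  proof (rule singular_field_tendsto[OF M])
    show "continuous_on UNIV (grad (U n))" for n
      using U(1) unfolding test_function_def by (intro continuous_on_grad) blast
    show "grad (U n) x = 0" if "norm x > R + 1" for n x
      using partial_eq_0_outside[OF U(2) that] by (simp add: grad_def vec_eq_iff)
    show "norm (grad (U n) x) \<le> (\<Sum>i\<in>UNIV. B i)" for n x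
      using U(3) by (intro order_trans[OF norm_le_l1_cart]) (auto simp: grad_def intro!: sum_mono)
    show "(\<lambda>n. grad (U n) x) \<longlonglongrightarrow> grad f x" for x
      by (rule vec_tendstoI) (simp add: grad_def U(4))
  qed
  moreover have "singular_field N S p q t (grad (U n)) = 0" for n
    using closed U(1) by (simp add: closed_two_form_def dist_div_def)
  ultimately show ?thesis by (simp add: LIMSEQ_const_iff)
qed


subsection \<open>Transport of pairings along the flow\<close>

lemma jac_norm_nonneg: "jac_norm w x \<ge> 0"
  by (simp add: jac_norm_def sum_nonneg)

lemma norm_grad_dot_le: "norm (grad_dot w x y) \<le> jac_norm w x * norm y"
proof -
  have "norm (grad_dot w x y) \<le> (\<Sum>i\<in>UNIV. \<bar>grad_dot w x y $ i\<bar>)" by (rule norm_le_l1_cart)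
  also have "\<dots> \<le> (\<Sum>i\<in>UNIV. \<Sum>j\<in>UNIV. \<bar>partial i (\<lambda>y. w y $ j) x\<bar> * norm y)"
  proof (rule sum_mono)
    fix i :: 3
    have "\<bar>grad_dot w x y $ i\<bar> \<le> (\<Sum>j\<in>UNIV. \<bar>partial i (\<lambda>y. w y $ j) x * y $ j\<bar>)"
      unfolding grad_dot_def vec_lambda_beta by (rule sum_abs)
    also have "\<dots> \<le> (\<Sum>j\<in>UNIV. \<bar>partial i (\<lambda>y. w y $ j) x\<bar> * norm y)"
      unfolding abs_mult by (intro sum_mono mult_left_mono component_le_norm_cart) simp
    finally show "\<bar>grad_dot w x y $ i\<bar> \<le> (\<Sum>j\<in>UNIV. \<bar>partial i (\<lambda>y. w y $ j) x\<bar> * norm y)" .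
  qed
  finally show ?thesis by (simp add: jac_norm_def sum_distrib_right)
qed

lemma norm_dot_grad_le: "norm (dot_grad y w x) \<le> jac_norm w x * norm y"
proof -
  have "norm (dot_grad y w x) \<le> (\<Sum>i\<in>UNIV. \<bar>dot_grad y w x $ i\<bar>)" by (rule norm_le_l1_cart)
  also have "\<dots> \<le> (\<Sum>i\<in>UNIV. \<Sum>j\<in>UNIV. \<bar>partial j (\<lambda>y. w y $ i) x\<bar> * norm y)"
  proof (rule sum_mono)
    fix i :: 3
    have "\<bar>dot_grad y w x $ i\<bar> \<le> (\<Sum>j\<in>UNIV. \<bar>y $ j * partial j (\<lambda>y. w y $ i) x\<bar>)"
      unfolding dot_grad_def vec_lambda_beta by (rule sum_abs)
    also have "\<dots> \<le> (\<Sum>j\<in>UNIV. \<bar>partial j (\<lambda>y. w y $ i) x\<bar> * norm y)"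
      unfolding abs_mult mult.commute[of "\<bar>y $ _\<bar>"]
      by (intro sum_mono mult_left_mono component_le_norm_cart) simp
    finally show "\<bar>dot_grad y w x $ i\<bar> \<le> (\<Sum>j\<in>UNIV. \<bar>partial j (\<lambda>y. w y $ i) x\<bar> * norm y)" .
  qed
  also have "\<dots> = jac_norm w x * norm y"
    unfolding jac_norm_def sum_distrib_right by (rule sum.swap)
  finally show ?thesis .
qed

lemma abs_divergence_le: "\<bar>divergence w x\<bar> \<le> jac_norm w x"
proof -
  have "\<bar>divergence w x\<bar> \<le> (\<Sum>i\<in>UNIV. \<bar>partial i (\<lambda>y. w y $ i) x\<bar>)"
    unfolding divergence_def by (rule sum_abs)
  also have "\<dots> \<le> jac_norm w x"
    unfolding jac_norm_def by (intro sum_mono member_le_sum) auto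
  finally show ?thesis .
qed

lemma dot_grad_has_derivative:
  assumes "\<And>j. (\<lambda>y. w y $ j) differentiable (at x)"
  shows "(w has_derivative (\<lambda>h. dot_grad h w x)) (at x)"
proof -
  have "((\<lambda>y. w y $ i) has_derivative (\<lambda>h. dot_grad h w x $ i)) (at x)" for i
    using differentiable_has_derivative_partials[OF assms[of i]] by (simp add: dot_grad_def)
  then show ?thesis
    by (subst has_derivative_componentwise_within) (auto simp: Basis_vec_def inner_axis)
qed

lemma test_field_C1_field: "test_field \<phi> \<Longrightarrow> C1_field \<phi>"
  unfolding test_field_def test_function_def C1_field_def by blast

lemma test_field_support:
  assumes "test_field \<phi>"
  obtains R where "\<And>x. norm x > R \<Longrightarrow> \<phi> x = 0"
proof -
  have "\<exists>R. \<forall>x. \<phi> x $ i \<noteq> 0 \<longrightarrow> norm x \<le> R" for i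
  proof -
    have "bounded (closure {x. \<phi> x $ i \<noteq> 0})"
      using assms compact_imp_bounded by (auto simp: test_field_def test_function_def)
    then show ?thesis unfolding bounded_iff using closure_subset[of "{x. \<phi> x $ i \<noteq> 0}"] by blast
  qed
  then obtain R where R: "\<And>i x. \<phi> x $ i \<noteq> 0 \<Longrightarrow> norm x \<le> R i" by metis
  have "\<phi> x = 0" if "norm x > Max (range R)" for x
  proof -
    have "R i \<le> Max (range R)" for i by simp
    then have "\<not> norm x \<le> R i" for i using that by (meson not_le order_trans)
    then show ?thesis using R by (auto simp: vec_eq_iff)
  qed
  then show thesis using that by blast
qed

lemma C1_velocity_C1_field: "C1_velocity T v \<Longrightarrow> t \<in> T \<Longrightarrow> C1_field (v t)"
  unfolding C1_field_def Ck.simps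
proof (intro allI conjI)
  fix i j x assume *: "C1_velocity T v" "t \<in> T"
  have "v t differentiable (at x)" using * by (simp add: C1_velocity_def)
  then show "(\<lambda>x. v t x $ j) differentiable (at x)"
    unfolding differentiable_def using bounded_linear.has_derivative[OF bounded_linear_vec_nth] by blast
  have "continuous_on (T \<times> UNIV) (\<lambda>(t, x). partial i (\<lambda>y. v t y $ j) x)"
    using * by (simp add: C1_velocity_def)
  then have "continuous_on UNIV (\<lambda>x. (\<lambda>(t, x). partial i (\<lambda>y. v t y $ j) x) (t, x))"
    by (rule continuous_on_compose2) (use * in \<open>auto intro!: continuous_intros\<close>)
  then show "continuous_on UNIV (partial i (\<lambda>x. v t x $ j))" by simp
qed

text \<open>\<open>G\<close> stands for the right-hand side of either evolution equation for
  \<open>p\<close>, so one differentiation under the integral serves both. The factor 2 in its bound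
  leaves room for the two terms of the one-form equation. The identity for \<open>\<Psi>\<close>
  concerns the time \<open>t\<close> alone.\<close>

lemma transport_pairing_has_derivative:
  fixes p q :: "'s \<Rightarrow> real \<Rightarrow> real^3" and G :: "real \<Rightarrow> real^3 \<Rightarrow> real^3 \<Rightarrow> real^3"
  assumes T: "is_interval T" "t \<in> T" and v: "C1_velocity T v"
    and M: "\<And>\<tau>. \<tau> \<in> T \<Longrightarrow> locally_finite_pairing M (\<lambda>s. p s \<tau>) (\<lambda>s. q s \<tau>)"
    and dq: "\<And>s \<tau>. s \<in> space M \<Longrightarrow> \<tau> \<in> T \<Longrightarrow>
        (q s has_vector_derivative v \<tau> (q s \<tau>)) (at \<tau> within T)"
    and dp: "\<And>s \<tau>. s \<in> space M \<Longrightarrow> \<tau> \<in> T \<Longrightarrow>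
        (p s has_vector_derivative G \<tau> (q s \<tau>) (p s \<tau>)) (at \<tau> within T)"
    and G: "\<And>\<tau> x y. \<tau> \<in> T \<Longrightarrow> norm (G \<tau> x y) \<le> 2 * jac_norm (v \<tau>) x * norm y"
    and \<phi>: "test_field \<phi>"
    and \<Psi>: "\<And>x y. G t x y \<bullet> \<phi> x + y \<bullet> dot_grad (v t x) \<phi> x = y \<bullet> \<Psi> x"
  shows "((\<lambda>\<tau>. LINT s|M. p s \<tau> \<bullet> \<phi> (q s \<tau>)) has_real_derivative
      (LINT s|M. p s t \<bullet> \<Psi> (q s t))) (at t within T)"
proof -
  have C1: "C1_field \<phi>" using \<phi> by (rule test_field_C1_field)
  have c\<phi>: "continuous_on UNIV \<phi>" using C1 by (rule C1_field_continuous)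
  obtain R where R: "\<And>x. norm x > R \<Longrightarrow> \<phi> x = 0" using test_field_support[OF \<phi>] by blast
  obtain B where B: "B \<ge> 0" "\<And>x. norm (\<phi> x) \<le> B" using bounded_of_support_in_ball[OF c\<phi> R] by blast
  have "continuous_on UNIV (jac_norm \<phi>)"
    unfolding jac_norm_def by (intro continuous_intros C1_field_partial_continuous C1)
  moreover have "jac_norm \<phi> x = 0" if "norm x > R" for x
  proof -
    have "partial i (\<lambda>y. \<phi> y $ j) x = 0" for i j
      by (rule partial_eq_0_outside[OF _ that]) (simp add: R)
    then show ?thesis by (simp add: jac_norm_def)
  qed
  ultimately obtain B' where B': "B' \<ge> 0" "\<And>x. norm (jac_norm \<phi> x) \<le> B'"
    using bounded_of_support_in_ball[of "jac_norm \<phi>" R] by blast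
  have B'': "jac_norm \<phi> x \<le> B'" for x using B'(2)[of x] by simp
  \<comment> \<open>A preliminary compact window, of arbitrary length 1, on which \<open>v\<close>
    and its Jacobian can be bounded over the ball of radius \<open>R + 1\<close>.\<close>
  obtain a0 b0 where ab0: "a0 \<le> t" "t \<le> b0" "{a0..b0} \<subseteq> T" "at t within T = at t within {a0..b0}"
    using interval_neighbourhood[OF T zero_less_one] by metis
  let ?K = "{a0..b0} \<times> cball (0::real^3) (R + 1)"
  have K: "compact ?K" by (intro compact_Times) auto
  have sub: "?K \<subseteq> T \<times> UNIV" using ab0(3) by auto
  have "continuous_on (T \<times> UNIV) (\<lambda>z. norm (case z of (t, x) \<Rightarrow> v t x))"
    using v unfolding C1_velocity_def by (intro continuous_on_norm) blast
  then have "compact ((\<lambda>z. norm (case z of (t, x) \<Rightarrow> v t x)) ` ?K)"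
    by (intro compact_continuous_image K continuous_on_subset[OF _ sub])
  then have "bounded ((\<lambda>z. norm (case z of (t, x) \<Rightarrow> v t x)) ` ?K)" by (rule compact_imp_bounded)
  then obtain m where "\<forall>z\<in>?K. norm (norm (case z of (t, x) \<Rightarrow> v t x)) \<le> m"
    unfolding bounded_iff ball_simps by blast
  then have m: "norm (v \<tau> x) \<le> m" if "\<tau> \<in> {a0..b0}" "norm x \<le> R + 1" for \<tau> x
    using bspec[of ?K _ "(\<tau>, x)"] that by simp
  have "continuous_on (T \<times> UNIV) (\<lambda>z. jac_norm (v (fst z)) (snd z))"
  proof -
    have "continuous_on (T \<times> UNIV) (\<lambda>z. partial i (\<lambda>y. v (fst z) y $ j) (snd z))" for i j
      using v by (simp add: C1_velocity_def case_prod_beta)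
    then show ?thesis unfolding jac_norm_def by (intro continuous_intros)
  qed
  then have "compact ((\<lambda>z. jac_norm (v (fst z)) (snd z)) ` ?K)"
    by (intro compact_continuous_image K continuous_on_subset[OF _ sub])
  then have "bounded ((\<lambda>z. jac_norm (v (fst z)) (snd z)) ` ?K)" by (rule compact_imp_bounded)
  then obtain c where "\<forall>z\<in>?K. norm (jac_norm (v (fst z)) (snd z)) \<le> c"
    unfolding bounded_iff ball_simps by blast
  then have "\<bar>jac_norm (v \<tau>) x\<bar> \<le> c" if "\<tau> \<in> {a0..b0}" "norm x \<le> R + 1" for \<tau> x
    using bspec[of ?K _ "(\<tau>, x)"] that by simp
  then have c: "jac_norm (v \<tau>) x \<le> c" if "\<tau> \<in> {a0..b0}" "norm x \<le> R + 1" for \<tau> x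
    using that by (blast intro: order_trans[OF abs_ge_self])
  define C where "C = max c 0"
  define m' where "m' = max m 0"
  have C: "C \<ge> 0" "\<And>\<tau> x. \<tau> \<in> {a0..b0} \<Longrightarrow> norm x \<le> R + 1 \<Longrightarrow> jac_norm (v \<tau>) x \<le> C"
    using c by (simp_all add: C_def le_max_iff_disj)
  have m': "m' \<ge> 0" "\<And>\<tau> x. \<tau> \<in> {a0..b0} \<Longrightarrow> norm x \<le> R + 1 \<Longrightarrow> norm (v \<tau> x) \<le> m'"
    using m by (simp_all add: m'_def le_max_iff_disj)
  have "t \<in> {a0..b0}" using ab0 by simp
  moreover have "1 / (m' + 1) > 0" using m'(1) by simp
  \<comment> \<open>The final window depends on the speed bound just found: length at most
    \<open>1 / (m' + 1)\<close> gives travel below 1, and the added 1 covers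
    \<open>m' = 0\<close>.\<close>
  ultimately obtain a b where ab: "a \<le> t" "t \<le> b" "{a..b} \<subseteq> {a0..b0}" "b - a \<le> 1 / (m' + 1)"
      "at t within {a0..b0} = at t within {a..b}"
    using interval_neighbourhood[OF is_interval_cc, of t a0 b0 "1 / (m' + 1)"] by metis
  have at_eq: "at t within T = at t within {a..b}" using ab0(4) ab(5) by simp
  have t: "t \<in> {a..b}" using ab by simp
  have abT: "{a..b} \<subseteq> T" using ab(3) ab0(3) by (rule subset_trans)
  have len: "m' * (b - a) < 1"
  proof -
    have "m' * (b - a) \<le> m' * (1 / (m' + 1))" using ab(4) m'(1) by (intro mult_left_mono)
    also have "\<dots> < 1" using m'(1) by (simp add: field_simps)
    finally show ?thesis .
  qed
  \<comment> \<open>The first factor bounds the rate of change of \<open>h\<close> per unit of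
    \<open>norm (p s r)\<close>; the exponential, from growth at rate \<open>2 * C\<close>, replaces
    \<open>p\<close> at time \<open>r\<close> by \<open>p\<close> at time \<open>t\<close>.\<close>
  define L where "L = (2 * C * B + B' * m') * exp (2 * C * (b - a))"
  define h where "h s \<tau> = p s \<tau> \<bullet> \<phi> (q s \<tau>)" for s \<tau>
  define h' where "h' s \<tau> = G \<tau> (q s \<tau>) (p s \<tau>) \<bullet> \<phi> (q s \<tau>) + p s \<tau> \<bullet> dot_grad (v \<tau> (q s \<tau>)) \<phi> (q s \<tau>)" for s \<tau>
  have dqJ: "(q s has_vector_derivative v \<tau> (q s \<tau>)) (at \<tau> within {a..b})"
    if "s \<in> space M" "\<tau> \<in> {a..b}" for s \<tau>
    by (rule has_vector_derivative_within_subset[OF dq abT]) (use that abT in auto)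
  have dpJ: "(p s has_vector_derivative G \<tau> (q s \<tau>) (p s \<tau>)) (at \<tau> within {a..b})"
    if "s \<in> space M" "\<tau> \<in> {a..b}" for s \<tau>
    by (rule has_vector_derivative_within_subset[OF dp abT]) (use that abT in auto)
  have dh: "(h s has_vector_derivative h' s \<tau>) (at \<tau> within {a..b})"
    if s: "s \<in> space M" and \<tau>: "\<tau> \<in> {a..b}" for s \<tau>
  proof -
    let ?x = "q s \<tau>"
    have d\<phi>: "(\<phi> has_derivative (\<lambda>h. dot_grad h \<phi> ?x)) (at ?x)"
      by (intro dot_grad_has_derivative C1_field_component_differentiable C1)
    have "(\<phi> \<circ> q s has_derivative (\<lambda>h. dot_grad h \<phi> ?x) \<circ> (\<lambda>h. h *\<^sub>R v \<tau> ?x)) (at \<tau> within {a..b})"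
      using dqJ[OF s \<tau>] d\<phi> unfolding has_vector_derivative_def
      by (intro diff_chain_within) (auto intro: has_derivative_at_withinI)
    moreover have "(\<lambda>h. dot_grad h \<phi> ?x) \<circ> (\<lambda>h. h *\<^sub>R v \<tau> ?x) = (\<lambda>h. h *\<^sub>R dot_grad (v \<tau> ?x) \<phi> ?x)"
      using linear_cmul[OF has_derivative_linear[OF d\<phi>]] by (simp add: o_def)
    ultimately have "((\<lambda>\<tau>. \<phi> (q s \<tau>)) has_derivative (\<lambda>h. h *\<^sub>R dot_grad (v \<tau> ?x) \<phi> ?x)) (at \<tau> within {a..b})"
      by (simp add: o_def)
    from has_derivative_inner[OF dpJ[OF s \<tau>, unfolded has_vector_derivative_def] this]
    show ?thesis by (simp add: h_def[abs_def] h'_def has_vector_derivative_def algebra_simps)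
  qed
  have bound: "norm (h s \<tau> - h s t) \<le> L * norm (indicat_real (cball 0 (R + 1)) (q s t) *\<^sub>R p s t) * \<bar>\<tau> - t\<bar>"
    if s: "s \<in> space M" and \<tau>: "\<tau> \<in> {a..b}" for s \<tau>
  \<comment> \<open>Either the trajectory enters the ball of radius \<open>R\<close> at some moment
    of the window, and then it stays within radius \<open>R + 1\<close> throughout, or it never
    meets the support of \<open>\<phi>\<close>.\<close>
  proof (cases "\<exists>\<sigma>\<in>{a..b}. norm (q s \<sigma>) \<le> R")
    case True
    then obtain \<sigma> where \<sigma>: "\<sigma> \<in> {a..b}" "norm (q s \<sigma>) \<le> R" by blast
    have conf: "norm (q s r) \<le> R + 1" if "r \<in> {a..b}" for r
    proof (rule trajectory_confined[where q = "q s" and M = m'])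
      show "(q s has_vector_derivative v r (q s r)) (at r within {a..b})" if "r \<in> {a..b}" for r
        by (rule dqJ[OF s that])
      show "norm (v r (q s r)) \<le> m'" if "r \<in> {a..b}" "norm (q s r) \<le> R + 1" for r
        using m'(2) that ab(3) by blast
    qed (use len m'(1) \<sigma> that in auto)
    have GC: "norm (G r (q s r) (p s r)) \<le> 2 * C * norm (p s r)" if r: "r \<in> {a..b}" for r
    proof -
      have "norm (G r (q s r) (p s r)) \<le> 2 * jac_norm (v r) (q s r) * norm (p s r)"
        using G abT r by blast
      also have "\<dots> \<le> 2 * C * norm (p s r)"
        using C(2)[OF _ conf[OF r]] ab(3) r by (intro mult_right_mono) auto
      finally show ?thesis .
    qed
    have growth: "norm (p s r) \<le> exp (2 * C * (b - a)) * norm (p s t)" if "r \<in> {a..b}" for r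
      using norm_le_exp_growth[of a b "p s", OF dpJ[OF s] GC _ t that] C(1) by simp
    have "norm (h' s r) \<le> L * norm (p s t)" if r: "r \<in> {a..b}" for r
    proof -
      have "norm (h' s r) \<le> norm (G r (q s r) (p s r)) * norm (\<phi> (q s r)) +
          norm (p s r) * norm (dot_grad (v r (q s r)) \<phi> (q s r))"
        unfolding h'_def by (intro order_trans[OF norm_triangle_ineq] add_mono) (simp_all add: Cauchy_Schwarz_ineq2)
      also have "\<dots> \<le> (2 * C * norm (p s r)) * B + norm (p s r) * (B' * m')"
      proof (intro add_mono mult_mono GC r B order_refl)
        have "norm (v r (q s r)) \<le> m'" using m'(2)[OF _ conf[OF r]] ab(3) r by auto
        then show "norm (dot_grad (v r (q s r)) \<phi> (q s r)) \<le> B' * m'"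
          using B'(1) B'' by (intro order_trans[OF norm_dot_grad_le] mult_mono) auto
      qed (use C in auto)
      also have "\<dots> = (2 * C * B + B' * m') * norm (p s r)" by (simp add: algebra_simps)
      also have "\<dots> \<le> (2 * C * B + B' * m') * (exp (2 * C * (b - a)) * norm (p s t))"
        using C(1) B(1) B'(1) m'(1) by (intro mult_left_mono growth r) simp
      finally show ?thesis by (simp add: L_def mult.assoc)
    qed
    then have "norm (h s \<tau> - h s t) \<le> (L * norm (p s t)) * \<bar>\<tau> - t\<bar>"
      using dh[OF s] t \<tau> by (intro has_vector_derivative_norm_bound[of "{a..b}"]) auto
    \<comment> \<open>Confinement at time \<open>t\<close> itself makes the indicator equal to
      1.\<close>
    then show ?thesis using conf[OF t] by simp
  next
    case False
    then have "h s \<tau> = 0" "h s t = 0" using \<tau> t R by (auto simp: h_def not_le)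
    moreover have "L \<ge> 0" using C(1) B(1) B'(1) m'(1) by (simp add: L_def)
    ultimately show ?thesis by simp
  qed
  have int: "integrable M (\<lambda>s. h s \<tau>)" if "\<tau> \<in> {a..b}" for \<tau>
    unfolding h_def using that abT by (intro pairing_integrable[OF M c\<phi> R]) auto
  have "((\<lambda>\<tau>. LINT s|M. h s \<tau>) has_real_derivative (LINT s|M. h' s t)) (at t within {a..b})"
    \<comment> \<open>The limit of difference quotients is tested along sequences, since dominated
      convergence is a statement about sequences.\<close>
    unfolding has_field_derivative_iff tendsto_at_iff_sequentially o_def
  proof (intro allI impI)
    fix X :: "nat \<Rightarrow> real"
    assume X: "\<forall>i. X i \<in> {a..b} - {t}" "X \<longlonglongrightarrow> t"
    have "(\<lambda>i. LINT s|M. (h s (X i) - h s t) / (X i - t)) \<longlonglongrightarrow> (LINT s|M. h' s t)"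
    proof (rule integral_dominated_convergence)
      have lim: "(\<lambda>i. (h s (X i) - h s t) / (X i - t)) \<longlonglongrightarrow> h' s t" if "s \<in> space M" for s
      proof -
        have "(h s has_real_derivative h' s t) (at t within {a..b})"
          using dh[OF that t] by (simp add: has_real_derivative_iff_has_vector_derivative)
        then show ?thesis
          using X unfolding has_field_derivative_iff tendsto_at_iff_sequentially o_def by blast
      qed
      then show "AE s in M. (\<lambda>i. (h s (X i) - h s t) / (X i - t)) \<longlonglongrightarrow> h' s t" by (rule AE_I2)
      show meas: "(\<lambda>s. (h s (X i) - h s t) / (X i - t)) \<in> borel_measurable M" for i
        using int[of "X i"] int[OF t] X(1) by (intro borel_measurable_divide borel_measurable_diff) auto
      \<comment> \<open>\<open>h'\<close> involves \<open>G\<close>, for which no measurability is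
        given, so it is obtained as a limit of measurable quotients.\<close>
      show "(\<lambda>s. h' s t) \<in> borel_measurable M"
        by (rule borel_measurable_LIMSEQ_real[OF lim meas])
      show "integrable M (\<lambda>s. L * norm (indicat_real (cball 0 (R + 1)) (q s t) *\<^sub>R p s t))"
        using M[OF T(2)] unfolding locally_finite_pairing_def
        by (intro integrable_mult_right integrable_norm) (auto intro: compact_cball)
      show "AE s in M. norm ((h s (X i) - h s t) / (X i - t)) \<le>
          L * norm (indicat_real (cball 0 (R + 1)) (q s t) *\<^sub>R p s t)" for i
      proof (rule AE_I2)
        fix s assume "s \<in> space M"
        then have "norm (h s (X i) - h s t) \<le>
            L * norm (indicat_real (cball 0 (R + 1)) (q s t) *\<^sub>R p s t) * \<bar>X i - t\<bar>"
          using X(1) by (intro bound) auto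
        moreover have "\<bar>X i - t\<bar> > 0" using X(1) by auto
        ultimately show "norm ((h s (X i) - h s t) / (X i - t)) \<le>
            L * norm (indicat_real (cball 0 (R + 1)) (q s t) *\<^sub>R p s t)"
          by (simp only: real_norm_def abs_divide pos_divide_le_eq)
      qed
    qed
    moreover have "(LINT s|M. (h s (X i) - h s t) / (X i - t)) =
        ((LINT s|M. h s (X i)) - (LINT s|M. h s t)) / (X i - t)" for i
      using int[of "X i"] int[OF t] X(1) by (simp add: Bochner_Integration.integral_diff)
    ultimately show "(\<lambda>i. ((LINT s|M. h s (X i)) - (LINT s|M. h s t)) / (X i - t)) \<longlonglongrightarrow>
        (LINT s|M. h' s t)" by (simp only:)
  qed
  then show ?thesis by (simp add: at_eq h_def h'_def \<Psi>)
qed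


subsection \<open>Vector calculus identities\<close>

lemma C1_field_cross3:
  assumes "C1_field \<phi>" "C1_field w"
  shows "C1_field (\<lambda>x. cross3 (\<phi> x) (w x))"
proof -
  have "\<forall>i. Ck (Suc 0) (\<lambda>x. cross3 (\<phi> x) (w x) $ i)"
    using assms unfolding forall_3 cross_components C1_field_def
    by (intro conjI Ck_diff Ck_mult) blast+
  then show ?thesis unfolding C1_field_def .
qed

lemma C1_inner:
  assumes "C1_field \<phi>" "C1_field w"
  shows "Ck (Suc 0) (\<lambda>x. \<phi> x \<bullet> w x)"
  using assms unfolding inner_vec_def inner_real_def C1_field_def by (intro Ck_sum Ck_mult) blast+

text \<open>Expand \<open>curl (\<phi> \<times> w)\<close> as \<open>\<phi> div w - w div \<phi> +
  (w . grad) \<phi> - (\<phi> . grad) w\<close>; pairing the last term with \<open>y\<close> is the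
  same as pairing \<open>grad_dot w x y\<close> with \<open>\<phi>\<close>.\<close>

lemma one_form_transport_identity:
  assumes "C1_field \<phi>" "C1_field w"
  shows "(divergence w x *\<^sub>R y - grad_dot w x y) \<bullet> \<phi> x + y \<bullet> dot_grad (w x) \<phi> x =
    y \<bullet> (curl (\<lambda>x. cross3 (\<phi> x) (w x)) x + divergence \<phi> x *\<^sub>R w x)"
proof -
  note d = C1_field_component_differentiable[OF assms(1)] C1_field_component_differentiable[OF assms(2)]
  have "partial i (\<lambda>x. \<phi> x $ j * w x $ k - w x $ j * \<phi> x $ k) x =
      \<phi> x $ j * partial i (\<lambda>x. w x $ k) x + partial i (\<lambda>x. \<phi> x $ j) x * w x $ k -
      (w x $ j * partial i (\<lambda>x. \<phi> x $ k) x + partial i (\<lambda>x. w x $ j) x * \<phi> x $ k)" for i j k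
    by (subst partial_diff) (simp_all add: partial_mult d differentiable_mult)
  note e = this
  show ?thesis
    unfolding curl_def cross_components e
    by (simp add: inner_vec_def sum_3 divergence_def grad_dot_def dot_grad_def algebra_simps)
qed

text \<open>The \<open>j\<close>-th component of \<open>curl \<phi> \<times> w\<close> is the sum
  over \<open>i\<close> of \<open>w_i (d_i \<phi>_j - d_j \<phi>_i)\<close>. Adding the gradient of
  \<open>\<phi> \<bullet> w\<close> cancels the second half and leaves derivatives of
  \<open>w\<close> contracted with \<open>\<phi>\<close>.\<close>

lemma two_form_transport_identity:
  assumes "C1_field \<phi>" "C1_field w"
  shows "dot_grad y w x \<bullet> \<phi> x + y \<bullet> dot_grad (w x) \<phi> x =
    y \<bullet> (cross3 (curl \<phi> x) (w x) + grad (\<lambda>x. \<phi> x \<bullet> w x) x)"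
proof -
  note d = C1_field_component_differentiable[OF assms(1)] C1_field_component_differentiable[OF assms(2)]
  have e: "partial i (\<lambda>x. \<phi> x $ 1 * w x $ 1 + \<phi> x $ 2 * w x $ 2 + \<phi> x $ 3 * w x $ 3) x =
      (\<phi> x $ 1 * partial i (\<lambda>x. w x $ 1) x + partial i (\<lambda>x. \<phi> x $ 1) x * w x $ 1) +
      (\<phi> x $ 2 * partial i (\<lambda>x. w x $ 2) x + partial i (\<lambda>x. \<phi> x $ 2) x * w x $ 2) +
      (\<phi> x $ 3 * partial i (\<lambda>x. w x $ 3) x + partial i (\<lambda>x. \<phi> x $ 3) x * w x $ 3)" for i
    by (simp add: partial_add partial_mult d differentiable_mult differentiable_add)
  have g: "grad (\<lambda>x. \<phi> x \<bullet> w x) x = (\<chi> i.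
      (\<phi> x $ 1 * partial i (\<lambda>x. w x $ 1) x + partial i (\<lambda>x. \<phi> x $ 1) x * w x $ 1) +
      (\<phi> x $ 2 * partial i (\<lambda>x. w x $ 2) x + partial i (\<lambda>x. \<phi> x $ 2) x * w x $ 2) +
      (\<phi> x $ 3 * partial i (\<lambda>x. w x $ 3) x + partial i (\<lambda>x. \<phi> x $ 3) x * w x $ 3))"
    unfolding grad_def inner_vec_def sum_3 inner_real_def e ..
  show ?thesis
    unfolding g
    by (simp add: inner_vec_def sum_3 cross_components dot_grad_def curl_def algebra_simps)
qed

subsection \<open>The flow equations for singular fields\<close>

lemma singular_field_has_derivative:
  assumes "is_interval T" "t \<in> T" "C1_velocity T v" "locally_finite_singular N S p q T"
    and ev: "\<And>a s \<tau>. a \<le> N \<Longrightarrow> s \<in> S a \<Longrightarrow> \<tau> \<in> T \<Longrightarrow>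
        (q a s has_vector_derivative v \<tau> (q a s \<tau>)) (at \<tau> within T) \<and>
        (p a s has_vector_derivative G \<tau> (q a s \<tau>) (p a s \<tau>)) (at \<tau> within T)"
    and "\<And>\<tau> x y. \<tau> \<in> T \<Longrightarrow> norm (G \<tau> x y) \<le> 2 * jac_norm (v \<tau>) x * norm y"
    and "test_field \<phi>"
    and "\<And>x y. G t x y \<bullet> \<phi> x + y \<bullet> dot_grad (v t x) \<phi> x = y \<bullet> \<Psi> x"
  shows "((\<lambda>\<tau>. singular_field N S p q \<tau> \<phi>) has_real_derivative singular_field N S p q t \<Psi>)
    (at t within T)"
  unfolding singular_field_def
proof (rule DERIV_sum)
  fix a assume "a \<in> {0..N}"
  then have a: "a \<le> N" by simp
  show "((\<lambda>\<tau>. LINT s|lebesgue_on (S a). p a s \<tau> \<bullet> \<phi> (q a s \<tau>)) has_real_derivative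
      (LINT s|lebesgue_on (S a). p a s t \<bullet> \<Psi> (q a s t))) (at t within T)"
    by (rule transport_pairing_has_derivative[OF assms(1,2,3)
          locally_finite_singularD[OF assms(4) a] _ _ assms(6,7,8)])
      (use ev a in \<open>auto simp: space_restrict_space\<close>)
qed

lemma continuous_on_divergence: "C1_field w \<Longrightarrow> continuous_on A (divergence w)"
  unfolding divergence_def by (intro continuous_intros C1_field_partial_continuous)

lemma singular_one_form_solution:
  assumes T: "is_interval T" and v: "C1_velocity T v" and M: "locally_finite_singular N S p q T"
    and closed: "\<forall>t\<in>T. closed_one_form (singular_field N S p q t)"
    and vel: "\<forall>t\<in>T. one_form_velocity E \<mu> (singular_field N S p q t) (v t)"
    and ev: "one_form_evolution N S p q T v"
  shows "one_form_flow_solution E \<mu> T (singular_field N S p q) v"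
  unfolding one_form_flow_solution_def
proof (intro ballI conjI allI impI)
  fix t \<phi> assume t: "t \<in> T" and \<phi>: "test_field \<phi>"
  let ?\<kappa> = "singular_field N S p q t"
  let ?w = "\<lambda>x. cross3 (\<phi> x) (v t x)"
  note C\<phi> = test_field_C1_field[OF \<phi>] and Cv = C1_velocity_C1_field[OF v]
  have Cw: "C1_field ?w" by (rule C1_field_cross3[OF C\<phi> Cv[OF t]])
  obtain R where R: "\<And>x. norm x > R \<Longrightarrow> \<phi> x = 0" using test_field_support[OF \<phi>] by blast
  have Rw: "?w x = 0" if "norm x > R" for x using R[OF that] by (simp add: cross_zero_left)
  have p0: "partial i (\<lambda>x. f x $ j) x = 0"
    if "norm x > R" "\<And>x. norm x > R \<Longrightarrow> f x = 0" for f :: "real^3 \<Rightarrow> real^3" and i j x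
    by (rule partial_eq_0_outside[OF _ that(1)]) (simp add: that(2))
  have "((\<lambda>\<tau>. singular_field N S p q \<tau> \<phi>) has_real_derivative
      ?\<kappa> (\<lambda>x. curl ?w x + divergence \<phi> x *\<^sub>R v t x)) (at t within T)"
  proof (rule singular_field_has_derivative[OF T t v M,
        where G = "\<lambda>\<tau> x y. divergence (v \<tau>) x *\<^sub>R y - grad_dot (v \<tau>) x y"])
    show "norm (divergence (v \<tau>) x *\<^sub>R y - grad_dot (v \<tau>) x y) \<le> 2 * jac_norm (v \<tau>) x * norm y" for \<tau> x y
    proof -
      \<comment> \<open>The divergence term and the gradient term each cost one
        \<open>jac_norm\<close>, which accounts for the factor 2.\<close>
      have "norm (divergence (v \<tau>) x *\<^sub>R y) \<le> jac_norm (v \<tau>) x * norm y"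
        by (simp add: abs_divergence_le mult_right_mono)
      then show ?thesis
        using norm_triangle_ineq4[of "divergence (v \<tau>) x *\<^sub>R y" "grad_dot (v \<tau>) x y"]
          norm_grad_dot_le[of "v \<tau>" x y] by linarith
    qed
  qed (use ev \<phi> one_form_transport_identity[OF C\<phi> Cv[OF t]] in \<open>auto simp: one_form_evolution_def\<close>)
  also have "?\<kappa> (\<lambda>x. curl ?w x + divergence \<phi> x *\<^sub>R v t x) =
      ?\<kappa> (curl ?w) + ?\<kappa> (\<lambda>x. divergence \<phi> x *\<^sub>R v t x)"
  \<comment> \<open>Both summands are continuous with support in the ball of radius
    \<open>R\<close>, so each is integrable and the pairing may be split.\<close>
  proof (rule singular_field_add[OF M t])
    show "continuous_on UNIV (curl ?w)" by (rule continuous_on_curl[OF Cw])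
    show "curl ?w x = 0" if "norm x > R" for x
      using p0[OF that Rw] by (simp add: curl_def vec_eq_iff forall_3)
    show "continuous_on UNIV (\<lambda>x. divergence \<phi> x *\<^sub>R v t x)"
      by (intro continuous_intros continuous_on_divergence C\<phi> C1_field_continuous Cv t)
    show "divergence \<phi> x *\<^sub>R v t x = 0" if "norm x > R" for x
      using p0[OF that R] by (simp add: divergence_def)
  qed
  \<comment> \<open>The only use of closedness: \<open>\<phi> \<times> v\<close> is C1 with compact
    support, but in general not a test field.\<close>
  also have "?\<kappa> (curl ?w) = 0" using closed t by (intro closed_one_form_C1_field[OF M t _ Cw Rw]) auto
  finally show "((\<lambda>\<tau>. singular_field N S p q \<tau> \<phi>) has_real_derivative
      - dist_grad (dist_inner (v t) ?\<kappa>) \<phi>) (at t within T)"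
    \<comment> \<open>The minus sign of the equation cancels the one from integration by parts in
      \<open>dist_grad\<close>.\<close>
    by (simp add: dist_grad_def dist_inner_def)
qed (use closed vel in auto)

lemma singular_two_form_solution:
  assumes T: "is_interval T" and v: "C1_velocity T v" and M: "locally_finite_singular N S p q T"
    and closed: "\<forall>t\<in>T. closed_two_form (singular_field N S p q t)"
    and vel: "\<forall>t\<in>T. two_form_velocity E \<mu> (singular_field N S p q t) (v t)"
    and ev: "two_form_evolution N S p q T v"
  shows "two_form_flow_solution E \<mu> T (singular_field N S p q) v"
  unfolding two_form_flow_solution_def
proof (intro ballI conjI allI impI)
  fix t \<phi> assume t: "t \<in> T" and \<phi>: "test_field \<phi>"
  let ?\<kappa> = "singular_field N S p q t"
  let ?f = "\<lambda>x. \<phi> x \<bullet> v t x"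
  note C\<phi> = test_field_C1_field[OF \<phi>] and Cv = C1_velocity_C1_field[OF v]
  have Cf: "Ck (Suc 0) ?f" by (rule C1_inner[OF C\<phi> Cv[OF t]])
  obtain R where R: "\<And>x. norm x > R \<Longrightarrow> \<phi> x = 0" using test_field_support[OF \<phi>] by blast
  have Rf: "?f x = 0" if "norm x > R" for x using R[OF that] by simp
  have p0: "partial i (\<lambda>x. \<phi> x $ j) x = 0" if "norm x > R" for i j x
    by (rule partial_eq_0_outside[OF _ that]) (simp add: R)
  have "((\<lambda>\<tau>. singular_field N S p q \<tau> \<phi>) has_real_derivative
      ?\<kappa> (\<lambda>x. cross3 (curl \<phi> x) (v t x) + grad ?f x)) (at t within T)"
  proof (rule singular_field_has_derivative[OF T t v M,
        where G = "\<lambda>\<tau> x y. dot_grad y (v \<tau>) x"])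
    show "norm (dot_grad y (v \<tau>) x) \<le> 2 * jac_norm (v \<tau>) x * norm y" for \<tau> x y
      using norm_dot_grad_le[of y "v \<tau>" x] mult_nonneg_nonneg[OF jac_norm_nonneg[of "v \<tau>" x] norm_ge_zero[of y]]
      by linarith
  qed (use ev \<phi> two_form_transport_identity[OF C\<phi> Cv[OF t]] in \<open>auto simp: two_form_evolution_def\<close>)
  also have "?\<kappa> (\<lambda>x. cross3 (curl \<phi> x) (v t x) + grad ?f x) =
      ?\<kappa> (\<lambda>x. cross3 (curl \<phi> x) (v t x)) + ?\<kappa> (grad ?f)"
  proof (rule singular_field_add[OF M t])
    show "continuous_on UNIV (\<lambda>x. cross3 (curl \<phi> x) (v t x))"
      by (intro continuous_on_cross continuous_on_curl C\<phi> C1_field_continuous Cv t)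
    show "cross3 (curl \<phi> x) (v t x) = 0" if "norm x > R" for x
    proof -
      have "curl \<phi> x = 0" using p0[OF that] by (simp add: curl_def vec_eq_iff forall_3)
      then show ?thesis by (simp add: cross_zero_left)
    qed
    show "continuous_on UNIV (grad ?f)" by (rule continuous_on_grad[OF Cf])
    show "grad ?f x = 0" if "norm x > R" for x
      using partial_eq_0_outside[OF Rf that] by (simp add: grad_def vec_eq_iff)
  qed
  \<comment> \<open>Closedness enters here, applied to the C1 function
    \<open>\<phi> \<bullet> v\<close>; the remaining term is the weak curl of
    \<open>v \<times> B\<close> by definition.\<close>
  also have "?\<kappa> (grad ?f) = 0" using closed t by (intro closed_two_form_C1[OF M t _ Cf Rf]) auto
  finally show "((\<lambda>\<tau>. singular_field N S p q \<tau> \<phi>) has_real_derivative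
      dist_curl (dist_cross (v t) ?\<kappa>) \<phi>) (at t within T)"
    by (simp add: dist_curl_def dist_cross_def)
qed (use closed vel in auto)

theorem proposition10:
  fixes E :: "vector_dist \<Rightarrow> real"
    and \<mu> :: "vector_dist \<Rightarrow> real^3 \<Rightarrow> real^3"
    and T :: "real set"
    and N :: nat
    and S :: "nat \<Rightarrow> 's::euclidean_space set"
    and p q :: "nat \<Rightarrow> 's \<Rightarrow> real \<Rightarrow> real^3"
    and v :: "real \<Rightarrow> real^3 \<Rightarrow> real^3"
    and \<kappa> :: "real \<Rightarrow> vector_dist"
  assumes "is_interval T"
    and "DIM('s) = 1 \<or> DIM('s) = 2"
    and "\<forall>a\<in>{0..N}. S a \<in> sets lebesgue"
    and "C1_velocity T v"
    and "locally_finite_singular N S p q T"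
    and "\<kappa> = singular_field N S p q"
  shows "((\<forall>t\<in>T. closed_one_form (\<kappa> t)) \<and>
          (\<forall>t\<in>T. one_form_velocity E \<mu> (\<kappa> t) (v t)) \<and>
          one_form_evolution N S p q T v
            \<longrightarrow> one_form_flow_solution E \<mu> T \<kappa> v) \<and>
         ((\<forall>t\<in>T. closed_two_form (\<kappa> t)) \<and>
          (\<forall>t\<in>T. two_form_velocity E \<mu> (\<kappa> t) (v t)) \<and>
          two_form_evolution N S p q T v
            \<longrightarrow> two_form_flow_solution E \<mu> T \<kappa> v)"
  using singular_one_form_solution[OF assms(1,4,5)] singular_two_form_solution[OF assms(1,4,5)]
  unfolding assms(6) by blast

end
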